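(* Let $q$ be an odd prime power, $n\geq 3$ odd, $\xi$ a non-square in $\mathbb{F}_q$, $r$ an integer with $\gcd(n,r)=1$, $a\in\mathbb{F}_{q^n}^*$ with $N_q(a)\neq1$, and $A_{a,r}(x)=x^{q^r}-ax^{q^{n-r}}$. Consider the $\mathbb{F}_q$-linear set $$L_{\mathcal{D}_A}=\{\langle(x,y,A_{a,r}(y),\xi A_{a,r}(x))\rangle : x,y\in\mathbb{F}_{q^n},\ (x,y)\neq(0,0)\}\subset PG(3,q^n).$$ Then: (i) If $N_q(a)\neq-1$ and $n=3$, then $L_{\mathcal{D}_A}$ is a maximum scattered $\mathbb{F}_q$-linear set of $PG(3,q^3)$ of pseudoregulus type. (ii) If $N_q(a)\neq-1$ and $n>3$, then $L_{\mathcal{D}_A}$ is a maximum scattered $\mathbb{F}_q$-linear set of $PG(3,q^n)$, and the lines $X_1=X_2=0$ and $X_0=X_3=0$ are two long lines of it that are not of pseudoregulus type. (iii) If $N_q(a)=-1$, then the points of $L_{\mathcal{D}_A}$ of weight bigger than $1$ have weight $2$, there are $\frac{q^{n-1}-1}{q-1}$ of them, and $|L_{\mathcal{D}_A}|=\frac{q^{2n}-q^n}{q-1}+1$.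
   Context: $N_q$ denotes the norm from $\mathbb{F}_{q^n}$ to $\mathbb{F}_q$. For an $\mathbb{F}_q$-subspace $U$ of $V=\mathbb{F}_{q^n}^4$, $L_U=\{\langle\mathbf u\rangle:\mathbf u\in U\setminus\{0\}\}$ is an $\mathbb{F}_q$-linear set of rank $\dim_{\mathbb{F}_q}U$; the weight of a subspace $PG(W,\mathbb{F}_{q^n})$ in $L_U$ is $\dim_{\mathbb{F}_q}(W\cap U)$. $L_U$ is scattered if all its points have weight $1$, and maximum scattered in $PG(3,q^n)$ if moreover it has rank $2n$. For a scattered $L$, a long line is a line of weight $n$. A scattered $\mathbb{F}_q$-linear set $L$ of $PG(3,q^n)$ of rank $2n$ is of pseudoregulus type if there exist $q^n+1$ pairwise disjoint long lines of $L$ and exactly two lines disjoint from $L$ meeting each of these long lines. An $\mathbb{F}_q$-linear set of $PG(1,q^n)$ is of pseudoregulus type if it equals $\{\langle\lambda\mathbf w+\rho\lambda^\tau\mathbf v\rangle:\lambda\in\mathbb{F}_{q^n}^*\}$ for independent $\mathbf w,\mathbf v$, $\rho\in\mathbb{F}_{q^n}^*$ and an automorphism $\tau$ of $\mathbb{F}_{q^n}$ with fixed field $\mathbb{F}_q$; a line $r$ of $PG(3,q^n)$ is of pseudoregulus type (w.r.t. $L$) if $L\cap r$ is of pseudoregulus type as a linear set of $r$. *)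

theory Defs
  imports "HOL-Analysis.Analysis" "HOL-Number_Theory.Prime_Powers"
begin

text \<open>
  The extension \<open>F\<^bsub>q\<^sup>n\<^esub> / F\<^sub>q\<close> is given by two finite fields \<open>'a\<close> (of order \<open>q ^ n\<close>) and
  \<open>'k\<close> (of order \<open>q\<close>) together with a field embedding of \<open>'k\<close> into \<open>'a\<close>.  In this way
  subspaces and dimensions over \<open>F\<^sub>q\<close> are those of the library, for the scalar multiplication
  \<open>subscale \<iota>\<close>, while \<open>vec.subspace\<close>, \<open>vec.dim\<close>, \<open>vec.span\<close> are the notions over \<open>F\<^bsub>q\<^sup>n\<^esub>\<close>.
\<close>

definition field_embedding :: "('k::field \<Rightarrow> 'a::field) \<Rightarrow> bool" where
  "field_embedding \<iota> \<longleftrightarrow>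
     \<iota> 1 = 1 \<and> (\<forall>x y. \<iota> (x + y) = \<iota> x + \<iota> y) \<and> (\<forall>x y. \<iota> (x * y) = \<iota> x * \<iota> y)"

definition field_automorphism :: "('a::field \<Rightarrow> 'a) \<Rightarrow> bool" where
  "field_automorphism \<tau> \<longleftrightarrow> field_embedding \<tau> \<and> bij \<tau>"

definition subscale :: "('k::field \<Rightarrow> 'a::field) \<Rightarrow> 'k \<Rightarrow> 'a ^ 4 \<Rightarrow> 'a ^ 4" where
  "subscale \<iota> c v = \<iota> c *s v"

abbreviation sub_dim :: "('k::field \<Rightarrow> 'a::field) \<Rightarrow> ('a ^ 4) set \<Rightarrow> nat" where
  "sub_dim \<iota> \<equiv> vector_space.dim (subscale \<iota>)"

definition field_norm :: "nat \<Rightarrow> nat \<Rightarrow> 'a::field \<Rightarrow> 'a" where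
  "field_norm q n x = (\<Prod>i<n. x ^ (q ^ i))"


text \<open>
  Subspaces of \<open>PG(3, q\<^sup>n)\<close> are represented by the underlying vector subspaces of \<open>'a ^ 4\<close>, so
  that two of them meet if they share a nonzero vector.
\<close>

definition is_line :: "('a::field ^ 4) set \<Rightarrow> bool" where
  "is_line W \<longleftrightarrow> vec.subspace W \<and> vec.dim W = 2"

definition meets :: "('a::field ^ 4) set \<Rightarrow> ('a ^ 4) set \<Rightarrow> bool" where
  "meets W W' \<longleftrightarrow> W \<inter> W' \<noteq> {0}"

definition linear_set :: "('a::field ^ 4) set \<Rightarrow> ('a ^ 4) set set" where
  "linear_set U = {vec.span {u} |u. u \<in> U - {0}}"

definition points_on :: "('a::field ^ 4) set set \<Rightarrow> ('a ^ 4) set \<Rightarrow> ('a ^ 4) set set" where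
  "points_on L W = {P \<in> L. P \<subseteq> W}"

text \<open>
  Weights depend on the defining subspace \<open>U\<close> and not only on the point set \<open>linear_set U\<close>; hence
  the predicates below that involve weights or ranks take \<open>U\<close> as argument.
\<close>

definition weight :: "('k::field \<Rightarrow> 'a::field) \<Rightarrow> ('a ^ 4) set \<Rightarrow> ('a ^ 4) set \<Rightarrow> nat" where
  "weight \<iota> U W = sub_dim \<iota> (W \<inter> U)"

definition scattered :: "('k::field \<Rightarrow> 'a::field) \<Rightarrow> ('a ^ 4) set \<Rightarrow> bool" where
  "scattered \<iota> U \<longleftrightarrow>
     module.subspace (subscale \<iota>) U \<and> (\<forall>P \<in> linear_set U. weight \<iota> U P = 1)"

definition maximum_scattered :: "('k::field \<Rightarrow> 'a::field) \<Rightarrow> nat \<Rightarrow> ('a ^ 4) set \<Rightarrow> bool" where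
  "maximum_scattered \<iota> n U \<longleftrightarrow> scattered \<iota> U \<and> sub_dim \<iota> U = 2 * n"

definition long_line ::
  "('k::field \<Rightarrow> 'a::field) \<Rightarrow> nat \<Rightarrow> ('a ^ 4) set \<Rightarrow> ('a ^ 4) set \<Rightarrow> bool" where
  "long_line \<iota> n U W \<longleftrightarrow> is_line W \<and> weight \<iota> U W = n"

definition pseudoregulus_type ::
  "('k::{field,finite} \<Rightarrow> 'a::{field,finite}) \<Rightarrow> nat \<Rightarrow> ('a ^ 4) set \<Rightarrow> bool" where
  "pseudoregulus_type \<iota> n U \<longleftrightarrow>
     scattered \<iota> U \<and> sub_dim \<iota> U = 2 * n \<and>
     (\<exists>F. card F = CARD('k) ^ n + 1 \<and>
          (\<forall>l\<in>F. long_line \<iota> n U l) \<and>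
          (\<forall>l\<in>F. \<forall>m\<in>F. l \<noteq> m \<longrightarrow> \<not> meets l m) \<and>
          card {t. is_line t \<and> points_on (linear_set U) t = {} \<and> (\<forall>l\<in>F. meets t l)} = 2)"

definition pseudoregulus_type_on ::
  "('k::field \<Rightarrow> 'a::field) \<Rightarrow> ('a ^ 4) set \<Rightarrow> ('a ^ 4) set set \<Rightarrow> bool" where
  "pseudoregulus_type_on \<iota> W S \<longleftrightarrow>
     (\<exists>w\<in>W. \<exists>v\<in>W. \<exists>\<rho> \<tau>.
        w \<noteq> v \<and> vec.independent {w, v} \<and> \<rho> \<noteq> 0 \<and>
        field_automorphism \<tau> \<and> {x. \<tau> x = x} = range \<iota> \<and>
        S = {vec.span {c *s w + (\<rho> * \<tau> c) *s v} |c. c \<noteq> 0})"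

definition line_of_pseudoregulus_type ::
  "('k::field \<Rightarrow> 'a::field) \<Rightarrow> ('a ^ 4) set \<Rightarrow> ('a ^ 4) set \<Rightarrow> bool" where
  "line_of_pseudoregulus_type \<iota> U W \<longleftrightarrow>
     is_line W \<and> pseudoregulus_type_on \<iota> W (points_on (linear_set U) W)"


text \<open>
  For an arbitrary integer \<open>r\<close> the maps \<open>x \<mapsto> x\<^bsup>q\<^sup>r\<^esup>\<close> and \<open>x \<mapsto> x\<^bsup>q\<^sup>n\<^sup>-\<^sup>r\<^esup>\<close> are powers of the
  Frobenius automorphism \<open>x \<mapsto> x\<^sup>q\<close>, which has order \<open>n\<close>; their exponents are therefore
  reduced modulo \<open>n\<close>.
\<close>

definition frob :: "nat \<Rightarrow> nat \<Rightarrow> int \<Rightarrow> 'a::field \<Rightarrow> 'a" where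
  "frob q n s x = x ^ (q ^ nat (s mod int n))"

definition A_map :: "nat \<Rightarrow> nat \<Rightarrow> 'a::field \<Rightarrow> int \<Rightarrow> 'a \<Rightarrow> 'a" where
  "A_map q n a r x = frob q n r x - a * frob q n (int n - r) x"

definition D_A :: "nat \<Rightarrow> nat \<Rightarrow> 'a::field \<Rightarrow> int \<Rightarrow> 'a \<Rightarrow> ('a ^ 4) set" where
  "D_A q n a r \<xi> = {vector [x, y, A_map q n a r y, \<xi> * A_map q n a r x] |x y. True}"

text \<open>
  The coordinates \<open>X\<^sub>0, X\<^sub>1, X\<^sub>2, X\<^sub>3\<close> are the components \<open>v $ 1, v $ 2, v $ 3, v $ 4\<close>.
\<close>

definition line_X1_X2 :: "('a::field ^ 4) set" where
  "line_X1_X2 = {v. v $ 2 = 0 \<and> v $ 3 = 0}"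

definition line_X0_X3 :: "('a::field ^ 4) set" where
  "line_X0_X3 = {v. v $ 1 = 0 \<and> v $ 4 = 0}"

end

theory Submission
  imports Defs
begin

text \<open>
  Let \<open>\<sigma>\<close> be the automorphism \<open>x \<mapsto> x\<^bsup>q\<^sup>r\<^esup>\<close>, so that \<open>A x = \<sigma> x - a \<sigma>\<^sup>-\<^sup>1 x\<close>. A scalar \<open>l\<close> maps
  the vector of \<open>(x, y)\<close> back into the set iff \<open>A (l x) = l A x\<close> and \<open>A (l y) = l A y\<close>. With
  \<open>\<mu> = \<sigma>\<^sup>-\<^sup>1 l - l\<close> the first condition reads \<open>\<sigma> \<mu> \<sigma> x = - a \<mu> \<sigma>\<^sup>-\<^sup>1 x\<close>; for \<open>\<mu> \<noteq> 0\<close> and \<open>x \<noteq> 0\<close>, taking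
  norms gives \<open>N(a) = -1\<close> since \<open>n\<close> is odd. This proves scatteredness, and if \<open>N(a) = -1\<close> then
  counting the pairs \<open>(x, \<mu>)\<close> in two ways with Hilbert 90 yields the number of points of weight 2.

  For \<open>n = 3\<close> the functional \<open>u = x - \<sigma>\<^sup>-\<^sup>1(a) A x\<close> satisfies \<open>\<sigma> u = a \<sigma>(a) x + A x\<close>, so a linear change of
  coordinates turns the set into \<open>{(u, v, \<sigma> u, \<sigma> v)}\<close>, whose transversals can be computed directly.

  For \<open>n > 3\<close>, suppose that the points \<open>A x / x\<close> are those of a set of pseudoregulus type for \<open>\<tau>\<close>. All
  automorphisms are powers of \<open>\<tau>\<close>, and after a substitution the second set is \<open>{f x / x}\<close> for
  \<open>f = \<Sum> b\<^sub>i \<tau>\<^sup>i\<close>, where either at most one or all of the \<open>b\<^sub>i\<close> with \<open>0 < i < n\<close> are nonzero. The power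
  sums \<open>\<Sum> s\<close> and \<open>\<Sum> s \<tau>\<^sup>k(s)\<close> over the points \<open>s\<close> determine \<open>b\<^sub>0\<close> and \<open>b\<^sub>k \<tau>\<^sup>k(b\<^bsub>n-k\<^esub>)\<close>. For \<open>A\<close> the latter
  is nonzero for exactly two values of \<open>k\<close>, and this contradicts both possibilities.
\<close>

subsection \<open>Automorphisms of finite fields\<close>

text \<open>Translation by 1 permutes the ring, so adding 1 to every element leaves the sum of all
  elements unchanged.\<close>

lemma of_nat_CARD_eq_0: "of_nat (CARD('a::{ring_1,finite})) = (0::'a)"
proof -
  have "(\<Sum>x\<in>UNIV. x + 1) = (\<Sum>x\<in>UNIV. x :: 'a)"
    by (rule sum.reindex_bij_witness[of _ "\<lambda>x. x - 1" "\<lambda>x. x + 1"]) auto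
  then show ?thesis
    by (simp add: sum.distrib)
qed

text \<open>Multiplication by a nonzero \<open>x\<close> permutes the nonzero elements; comparing
  the two products of all of them gives Fermat's identity.\<close>

lemma finite_field_power_CARD: "x ^ CARD('a) = (x :: 'a :: {field,finite})"
proof (cases "x = 0")
  case False
  have "(\<Prod>y\<in>-{0}. x * y) = \<Prod>(-{0} :: 'a set)"
    by (rule prod.reindex_bij_witness[of _ "\<lambda>y. y / x" "\<lambda>y. x * y"]) (use False in auto)
  then have "x ^ card (-{0} :: 'a set) = 1"
    by (simp add: prod.distrib)
  moreover have "CARD('a) = Suc (card (-{0} :: 'a set))"
    using card_Suc_Diff1[of "UNIV :: 'a set" 0] by (simp add: Compl_eq_Diff_UNIV)
  ultimately show ?thesis
    by simp
qed auto

text \<open>Artin's elimination: subtracting \<open>g y\<close> times the relation at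
  \<open>x\<close> from the relation at \<open>y * x\<close> multiplies each coefficient by
  \<open>f y - g y\<close>. This removes \<open>g\<close> and, for suitable \<open>y\<close>, keeps
  a chosen \<open>h\<close>, so induction applies.\<close>

lemma dedekind_independence:
  fixes c :: "('a::monoid_mult \<Rightarrow> 'b::field) \<Rightarrow> 'b"
  assumes "finite X" and "\<And>f. f \<in> X \<Longrightarrow> f 1 = 1 \<and> (\<forall>x y. f (x * y) = f x * f y)"
    and "\<And>x. (\<Sum>f\<in>X. c f * f x) = 0" and "f \<in> X"
  shows "c f = 0"
  using assms
proof (induction X arbitrary: c f rule: finite_induct)
  case (insert g X)
  have zero: "c h = 0" if h: "h \<in> X" for h
  proof -
    obtain y where y: "h y \<noteq> g y"
      using h insert.hyps(2) by (metis ext)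
    define c' where "c' = (\<lambda>f. c f * (f y - g y))"
    have "(\<Sum>f\<in>X. c' f * f x) = 0" for x
    proof -
      have "(\<Sum>f\<in>insert g X. c f * f (y * x)) - g y * (\<Sum>f\<in>insert g X. c f * f x)
          = (\<Sum>f\<in>insert g X. c f * (f y * f x) - g y * (c f * f x))"
        using insert.prems(1) by (simp add: sum_distrib_left sum_subtractf)
      also have "\<dots> = (\<Sum>f\<in>insert g X. c' f * f x)"
        by (simp add: c'_def algebra_simps)
      also have "\<dots> = (\<Sum>f\<in>X. c' f * f x)"
        using insert.hyps by (simp add: c'_def)
      finally show ?thesis
        using insert.prems(2) by simp
    qed
    from insert.IH[OF _ this h] insert.prems(1) have "c' h = 0"
      by blast
    with y show ?thesis
      by (simp add: c'_def)
  qed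
  \<comment> \<open>All coefficients on \<open>X\<close> vanish by now, so evaluating at 1 isolates
    the coefficient of \<open>g\<close>.\<close>
  have "(\<Sum>f\<in>insert g X. c f * f 1) = c g"
    using insert.hyps insert.prems(1)[of g] zero by simp
  then show ?case
    using zero insert.prems(2)[of 1] insert.prems(3) by auto
qed simp

text \<open>Rescaling by some \<open>y\<close> with \<open>\<psi> y \<noteq> 1\<close> multiplies
  the sum by \<open>\<psi> y\<close>, so it is 0. For trivial \<open>\<psi>\<close> the sum counts
  the nonzero elements, and this count is -1 in the field itself.\<close>

lemma sum_character:
  fixes \<psi> :: "'a::{field,finite} \<Rightarrow> 'a"
  assumes mult: "\<And>x y. x \<noteq> 0 \<Longrightarrow> y \<noteq> 0 \<Longrightarrow> \<psi> (x * y) = \<psi> x * \<psi> y"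
  shows "(\<Sum>x\<in>-{0}. \<psi> x) = (if \<forall>x. x \<noteq> 0 \<longrightarrow> \<psi> x = 1 then -1 else 0)"
proof (cases "\<forall>x. x \<noteq> 0 \<longrightarrow> \<psi> x = 1")
  case True
  have "(\<Sum>x\<in>-{0}. \<psi> x) = of_nat (card (-{0} :: 'a set))"
    using True by (simp add: sum.cong)
  also have "CARD('a) = Suc (card (-{0} :: 'a set))"
    using card_Suc_Diff1[of "UNIV :: 'a set" 0] by (simp add: Compl_eq_Diff_UNIV)
  then have "of_nat (card (-{0} :: 'a set)) = of_nat (CARD('a)) - (1 :: 'a)"
    by simp
  finally show ?thesis
    using True by (simp add: of_nat_CARD_eq_0)
next
  case False
  then obtain y where y: "y \<noteq> 0" "\<psi> y \<noteq> 1"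
    by auto
  have "(\<Sum>x\<in>-{0}. \<psi> (y * x)) = (\<Sum>x\<in>-{0}. \<psi> x)"
    by (rule sum.reindex_bij_witness[of _ "\<lambda>x. x / y" "\<lambda>x. y * x"]) (use y in auto)
  moreover have "(\<Sum>x\<in>-{0}. \<psi> (y * x)) = \<psi> y * (\<Sum>x\<in>-{0}. \<psi> x)"
    using y by (simp add: mult sum_distrib_left)
  ultimately have "(\<psi> y - 1) * (\<Sum>x\<in>-{0}. \<psi> x) = 0"
    by (simp add: algebra_simps)
  with y False show ?thesis
    by simp
qed

locale field_aut =
  fixes \<sigma> :: "'a::field \<Rightarrow> 'a"
  assumes aut: "field_automorphism \<sigma>"
begin

lemma one [simp]: "\<sigma> 1 = 1"
  and add: "\<sigma> (x + y) = \<sigma> x + \<sigma> y"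
  and mult: "\<sigma> (x * y) = \<sigma> x * \<sigma> y"
  and bij: "bij \<sigma>"
  using aut by (auto simp: field_automorphism_def field_embedding_def)

lemma zero [simp]: "\<sigma> 0 = 0"
  by (metis add add_cancel_left_left)

lemma minus: "\<sigma> (- x) = - \<sigma> x"
  using add[of x "-x"] by (simp add: eq_neg_iff_add_eq_0 add.commute)

lemma diff: "\<sigma> (x - y) = \<sigma> x - \<sigma> y"
  using add[of x "-y"] by (simp add: minus)

lemma eq_iff [simp]: "\<sigma> x = \<sigma> y \<longleftrightarrow> x = y"
  using bij by (auto simp: bij_def inj_def)

lemma eq_0_iff [simp]: "\<sigma> x = 0 \<longleftrightarrow> x = 0"
  using eq_iff[of x 0] by simp

lemma divide: "\<sigma> (x / y) = \<sigma> x / \<sigma> y"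
proof (cases "y = 0")
  case False
  then show ?thesis
    using mult[of "x / y" y] by (simp add: field_simps)
qed simp

lemma sum: "\<sigma> (\<Sum>i\<in>I. f i) = (\<Sum>i\<in>I. \<sigma> (f i))"
  by (induction I rule: infinite_finite_induct) (auto simp: add)

lemma power: "\<sigma> (x ^ i) = \<sigma> x ^ i"
  by (induction i) (auto simp: mult)

lemmas hom = add mult minus diff divide power

lemma comp:
  assumes "field_aut \<tau>"
  shows "field_aut (\<sigma> \<circ> \<tau>)"
proof -
  interpret T: field_aut \<tau> by fact
  show ?thesis
    by unfold_locales (simp add: field_automorphism_def field_embedding_def hom T.hom
        bij_comp bij T.bij)
qed

lemma funpow: "field_aut (\<sigma> ^^ i)"
proof (induction i)
  case 0
  show ?case
    by unfold_locales (simp add: field_automorphism_def field_embedding_def flip: id_def)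
next
  case (Suc i)
  then show ?case
    using comp by (simp only: funpow.simps)
qed

lemma funpow_fixed: "\<sigma> x = x \<Longrightarrow> (\<sigma> ^^ i) x = x"
  by (induction i) auto

end

section \<open>Linear combinations of the powers of one automorphism, and their power sums\<close>

locale cyclic_aut = field_aut \<sigma> for \<sigma> :: "'a::{field,finite} \<Rightarrow> 'a" +
  fixes n :: nat
  assumes n_pos: "n > 0" and period: "\<sigma> ^^ n = id"
    and inj_pow: "inj_on (\<lambda>i. \<sigma> ^^ i) {..<n}"
begin

lemma pow_aut: "field_aut (\<sigma> ^^ i)"
  by (rule funpow)

lemma pow_mod: "\<sigma> ^^ (i mod n) = \<sigma> ^^ i"
proof -
  have "\<sigma> ^^ (n * (i div n)) = id"
    by (simp add: period flip: funpow_mult)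
  then have "\<sigma> ^^ (n * (i div n) + i mod n) = \<sigma> ^^ (i mod n)"
    by (simp only: funpow_add id_comp)
  then show ?thesis
    by simp
qed

lemma pow_eq_iff: "i < n \<Longrightarrow> j < n \<Longrightarrow> \<sigma> ^^ i = \<sigma> ^^ j \<longleftrightarrow> i = j"
  using inj_pow by (auto dest: inj_onD)

lemma independent:
  assumes "\<And>x. (\<Sum>i<n. c i * (\<sigma> ^^ i) x) = 0" and "i < n"
  shows "c i = 0"
proof -
  \<comment> \<open>Dedekind's lemma indexes coefficients by maps rather than exponents; injectivity
    of the powers lets the coefficients be transported.\<close>
  define c' where "c' = (\<lambda>f. c (the_inv_into {..<n} (\<lambda>i. \<sigma> ^^ i) f))"
  have c': "c' (\<sigma> ^^ j) = c j" if "j < n" for j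
    using that the_inv_into_f_f[OF inj_pow, of j] by (simp add: c'_def)
  have "(\<Sum>f\<in>(\<lambda>i. \<sigma> ^^ i) ` {..<n}. c' f * f x) = 0" for x
    using assms(1)[of x] inj_pow c' by (simp add: sum.reindex)
  moreover have "f 1 = 1 \<and> (\<forall>x y. f (x * y) = f x * f y)"
    if "f \<in> (\<lambda>i. \<sigma> ^^ i) ` {..<n}" for f
  proof -
    from that obtain i where "f = \<sigma> ^^ i" by auto
    then interpret field_aut f using pow_aut by simp
    show ?thesis by (simp add: hom)
  qed
  ultimately have "c' (\<sigma> ^^ i) = 0"
    using dedekind_independence[of "(\<lambda>i. \<sigma> ^^ i) ` {..<n}" c' "\<sigma> ^^ i"] assms(2) by simp
  with c' assms(2) show ?thesis by simp
qed

text \<open>This is the linearized polynomial of \<sigma> with coefficients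
  \<open>b\<close>.\<close>

definition lin :: "(nat \<Rightarrow> 'a) \<Rightarrow> 'a \<Rightarrow> 'a" where
  "lin b x = (\<Sum>i<n. b i * (\<sigma> ^^ i) x)"

text \<open>The quotient is a multiplicative character, and it is trivial only if
  \<open>\<sigma> ^^ i\<close> is the identity.\<close>

lemma sum_pow_over_id: 
  assumes "i < n"
  shows "(\<Sum>x\<in>-{0}. (\<sigma> ^^ i) x / x) = (if i = 0 then -1 else 0)"
proof -
  interpret I: field_aut "\<sigma> ^^ i" by (rule pow_aut)
  have "(\<forall>x. x \<noteq> 0 \<longrightarrow> (\<sigma> ^^ i) x / x = 1) \<longleftrightarrow> \<sigma> ^^ i = \<sigma> ^^ 0"
    by (auto simp: fun_eq_iff) (metis I.zero)
  also have "\<dots> \<longleftrightarrow> i = 0"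
    using assms n_pos pow_eq_iff by blast
  finally show ?thesis
    by (subst sum_character) (auto simp: I.hom)
qed

lemma sum_lin_over_id: "(\<Sum>x\<in>-{0}. lin b x / x) = - b 0"
proof -
  have "(\<Sum>x\<in>-{0}. lin b x / x) = (\<Sum>i<n. b i * (\<Sum>x\<in>-{0}. (\<sigma> ^^ i) x / x))"
    unfolding lin_def sum_divide_distrib sum_distrib_left
    by (subst sum.swap) simp
  also have "\<dots> = (\<Sum>i<n. if i = 0 then - b i else 0)"
    by (intro sum.cong) (auto simp: sum_pow_over_id)
  finally show ?thesis
    using n_pos by simp
qed

text \<open>Again a character sum. What has to be shown is that the character is trivial only when
  the exponents i, j are 0, k in some order.\<close>

lemma sum_pow_mult_pow:
  assumes "i < n" "j < n" "0 < k" "k < n" and two: "(2::'a) \<noteq> 0"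
  shows "(\<Sum>x\<in>-{0}. (\<sigma> ^^ i) x * (\<sigma> ^^ j) x / (x * (\<sigma> ^^ k) x)) =
           (if i = 0 \<and> j = k \<or> i = k \<and> j = 0 then -1 else 0)"
proof -
  interpret I: field_aut "\<sigma> ^^ i" by (rule pow_aut)
  interpret J: field_aut "\<sigma> ^^ j" by (rule pow_aut)
  interpret K: field_aut "\<sigma> ^^ k" by (rule pow_aut)
  have "i = 0 \<and> j = k \<or> i = k \<and> j = 0"
    if triv: "\<forall>x. x \<noteq> 0 \<longrightarrow> (\<sigma> ^^ i) x * (\<sigma> ^^ j) x / (x * (\<sigma> ^^ k) x) = 1"
  proof -
    have eq: "(\<sigma> ^^ i) x * (\<sigma> ^^ j) x = x * (\<sigma> ^^ k) x" for x
      using triv by (cases "x = 0") auto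
    \<comment> \<open>Substituting x + 1 into the multiplicative identity and cancelling leaves its
      linear part, to which independence applies.\<close>
    have lin: "(\<sigma> ^^ i) x + (\<sigma> ^^ j) x = x + (\<sigma> ^^ k) x" for x
      using eq[of "x + 1"] eq[of x] by (simp add: I.hom J.hom K.hom algebra_simps)
    \<comment> \<open>The coefficients of this linear relation, written as a sum of indicators so
      that coinciding exponents add up correctly.\<close>
    define c where "c = (\<lambda>l. (if l = i then 1 else 0) + (if l = j then 1 else 0)
       - (if l = 0 then 1 else 0) - (if l = k then 1 else 0 :: 'a))"
    have "(\<Sum>l<n. c l * (\<sigma> ^^ l) x) = 0" for x
    proof -
      have "(\<Sum>l<n. c l * (\<sigma> ^^ l) x) = (\<Sum>l<n. (if l = i then (\<sigma> ^^ l) x else 0)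
          + (if l = j then (\<sigma> ^^ l) x else 0) - (if l = 0 then (\<sigma> ^^ l) x else 0)
          - (if l = k then (\<sigma> ^^ l) x else 0))"
        by (rule sum.cong) (auto simp: c_def algebra_simps)
      also have "\<dots> = (\<sigma> ^^ i) x + (\<sigma> ^^ j) x - x - (\<sigma> ^^ k) x"
        using assms by (simp add: sum.distrib sum_subtractf)
      finally show ?thesis
        by (simp add: lin)
    qed
    then have c0: "c l = 0" if "l < n" for l
      using that by (rule independent)
    show ?thesis
      using c0[of 0] c0[of k] assms by (auto simp: c_def split: if_splits)
  qed
  moreover have "(\<sigma> ^^ i) x * (\<sigma> ^^ j) x / (x * (\<sigma> ^^ k) x) = 1"
    if "i = 0 \<and> j = k \<or> i = k \<and> j = 0" "x \<noteq> 0" for x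
    using that by auto
  ultimately show ?thesis
    by (subst sum_character) (auto simp: I.hom J.hom K.hom mult_ac)
qed

text \<open>Expanding both factors gives character sums with exponents i and k + j mod n. Only (i,
  j) = (0, 0) and (i, j) = (k, n - k) survive.\<close>

lemma sum_lin_mult_pow:
  assumes k: "0 < k" "k < n" and two: "(2::'a) \<noteq> 0"
  shows "(\<Sum>x\<in>-{0}. lin b x / x * (\<sigma> ^^ k) (lin b x / x)) =
           - (b 0 * (\<sigma> ^^ k) (b 0) + b k * (\<sigma> ^^ k) (b (n - k)))"
proof -
  interpret K: field_aut "\<sigma> ^^ k" by (rule pow_aut)
  let ?B = "\<lambda>i j. b i * (\<sigma> ^^ k) (b j)"
  let ?M = "\<lambda>i j x. (\<sigma> ^^ i) x * (\<sigma> ^^ ((k + j) mod n)) x / (x * (\<sigma> ^^ k) x)"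
  have "lin b x / x * (\<sigma> ^^ k) (lin b x / x) = (\<Sum>i<n. \<Sum>j<n. ?B i j * ?M i j x)" for x
  proof -
    have "(\<sigma> ^^ k) (lin b x) = (\<Sum>j<n. (\<sigma> ^^ k) (b j) * (\<sigma> ^^ ((k + j) mod n)) x)"
      by (simp add: lin_def K.sum K.mult pow_mod funpow_add)
    then have "lin b x * (\<sigma> ^^ k) (lin b x) = (\<Sum>i<n. \<Sum>j<n. b i * (\<sigma> ^^ i) x *
        ((\<sigma> ^^ k) (b j) * (\<sigma> ^^ ((k + j) mod n)) x))"
      by (simp add: lin_def sum_product)
    then show ?thesis
      by (simp add: K.divide sum_divide_distrib mult_ac)
  qed
  then have "(\<Sum>x\<in>-{0}. lin b x / x * (\<sigma> ^^ k) (lin b x / x))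
      = (\<Sum>x\<in>-{0}. \<Sum>i<n. \<Sum>j<n. ?B i j * ?M i j x)"
    by simp
  also have "\<dots> = (\<Sum>i<n. \<Sum>x\<in>-{0}. \<Sum>j<n. ?B i j * ?M i j x)"
    by (rule sum.swap)
  also have "\<dots> = (\<Sum>i<n. \<Sum>j<n. \<Sum>x\<in>-{0}. ?B i j * ?M i j x)"
    by (intro sum.cong refl sum.swap)
  also have "\<dots> = (\<Sum>i<n. \<Sum>j<n. ?B i j * (\<Sum>x\<in>-{0}. ?M i j x))"
    by (simp add: sum_distrib_left)
  also have "\<dots> = (\<Sum>i<n. \<Sum>j<n. if i = 0 then if j = 0 then - ?B i j else 0
                      else if i = k then if j = n - k then - ?B i j else 0 else 0)"
  proof (intro sum.cong refl)
    fix i j assume ij: "i \<in> {..<n}" "j \<in> {..<n}"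
    have 1: "(k + j) mod n = k \<longleftrightarrow> j = 0" and 2: "(k + j) mod n = 0 \<longleftrightarrow> j = n - k"
      using ij k by (auto simp: mod_if)
    show "?B i j * (\<Sum>x\<in>-{0}. ?M i j x) = (if i = 0 then if j = 0 then - ?B i j else 0
                      else if i = k then if j = n - k then - ?B i j else 0 else 0)"
      using ij k n_pos two by (subst sum_pow_mult_pow) (auto simp: 1 2)
  qed
  also have "\<dots> = (\<Sum>i<n. if i = 0 then - ?B i 0 else if i = k then - ?B i (n - k) else 0)"
    using k by (intro sum.cong refl) auto
  also have "\<dots> = (\<Sum>i<n. (if i = 0 then - ?B i 0 else 0) + (if i = k then - ?B i (n - k) else 0))"
    using k by (intro sum.cong refl) auto
  also have "\<dots> = - (b 0 * (\<sigma> ^^ k) (b 0) + b k * (\<sigma> ^^ k) (b (n - k)))"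
    using k n_pos by (simp add: sum.distrib)
  finally show ?thesis .
qed

end

subsection \<open>Cyclic groups of automorphisms\<close>

lemma (in field_aut) pow_diff_eq_id:
  assumes "i < j" "\<sigma> ^^ i = \<sigma> ^^ j"
  shows "\<sigma> ^^ (j - i) = id"
proof
  fix x
  interpret I: field_aut "\<sigma> ^^ i" by (rule funpow)
  have "(\<sigma> ^^ i) ((\<sigma> ^^ (j - i)) x) = (\<sigma> ^^ i) x"
    using assms by (metis comp_apply funpow_add le_add_diff_inverse less_imp_le)
  then show "(\<sigma> ^^ (j - i)) x = id x"
    by simp
qed

lemma (in field_aut) inj_on_pow_lessThan:
  assumes "\<And>d. 0 < d \<Longrightarrow> d < n \<Longrightarrow> \<sigma> ^^ d \<noteq> id"
  shows "inj_on (\<lambda>i. \<sigma> ^^ i) {..<n}"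
proof (rule linorder_inj_onI)
  fix i j assume ij: "i < j" "i \<in> {..<n}" "j \<in> {..<n}"
  show "\<sigma> ^^ i \<noteq> \<sigma> ^^ j"
  proof
    assume eq: "\<sigma> ^^ i = \<sigma> ^^ j"
    then have "\<sigma> ^^ (j - i) = id"
      using ij by (intro pow_diff_eq_id) auto
    then show False
      using assms[of "j - i"] ij by (simp add: less_imp_diff_less)
  qed
qed auto

text \<open>A finite type has finitely many self-maps, so two powers agree; the least positive
  period is the required order.\<close>

lemma cyclic_aut_exists:
  fixes \<sigma> :: "'a::{field,finite} \<Rightarrow> 'a"
  assumes "field_aut \<sigma>"
  shows "\<exists>n. cyclic_aut \<sigma> n"
proof -
  interpret field_aut \<sigma> by fact
  have "\<not> inj (\<lambda>i. \<sigma> ^^ i)"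
    using finite_imageD[of "\<lambda>i. \<sigma> ^^ i" UNIV] by (auto simp: finite_subset)
  then obtain i j where ij: "i < j" "\<sigma> ^^ i = \<sigma> ^^ j"
    by (auto simp: inj_def) (metis linorder_neqE_nat)
  then have ex: "0 < j - i \<and> \<sigma> ^^ (j - i) = id"
    by (simp add: pow_diff_eq_id)
  define n where "n = (LEAST d. 0 < d \<and> \<sigma> ^^ d = id)"
  have n: "0 < n" "\<sigma> ^^ n = id"
    using LeastI[of "\<lambda>d. 0 < d \<and> \<sigma> ^^ d = id", OF ex] by (auto simp: n_def)
  have "\<sigma> ^^ d \<noteq> id" if "0 < d" "d < n" for d
    using not_less_Least[of d "\<lambda>d. 0 < d \<and> \<sigma> ^^ d = id"] that by (auto simp: n_def)
  then have "cyclic_aut \<sigma> n"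
    using n inj_on_pow_lessThan by unfold_locales auto
  then show ?thesis ..
qed

context cyclic_aut
begin

text \<open>Applying \<sigma> shifts the trace by one index, and by \<open>period\<close> the term
  that enters equals the one that leaves.\<close>

lemma sum_pow_fixed: "\<sigma> (\<Sum>i<n. (\<sigma> ^^ i) x) = (\<Sum>i<n. (\<sigma> ^^ i) x)"
proof -
  have "\<sigma> (\<Sum>i<n. (\<sigma> ^^ i) x) + x = (\<Sum>i<Suc n. (\<sigma> ^^ i) x)"
    by (simp add: sum sum.lessThan_Suc_shift del: sum.lessThan_Suc)
  then show ?thesis
    by (simp add: period)
qed

text \<open>If \<open>\<tau>\<close> is not a power of \<open>\<sigma>\<close>, then the identity \<open>\<tau> \<circ> Tr = Tr\<close> is a nontrivial linear
  relation between distinct automorphisms.\<close>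

lemma aut_is_pow:
  assumes "field_aut \<tau>" and fixed: "\<And>x. \<sigma> x = x \<Longrightarrow> \<tau> x = x"
  shows "\<exists>j<n. \<tau> = \<sigma> ^^ j"
proof (rule ccontr)
  assume no: "\<not> (\<exists>j<n. \<tau> = \<sigma> ^^ j)"
  interpret T: field_aut \<tau> by fact
  let ?X = "(\<lambda>i. \<sigma> ^^ i) ` {..<n}" and ?Y = "(\<lambda>i. \<tau> \<circ> \<sigma> ^^ i) ` {..<n}"
  \<comment> \<open>A common element would express \<tau> itself as a power of \<sigma>, after
    composing with the inverse power \<open>\<sigma> ^^ (n - i)\<close>.\<close>
  have disj: "?X \<inter> ?Y = {}"
  proof (rule ccontr)
    assume "?X \<inter> ?Y \<noteq> {}"
    then obtain i j where ij: "i < n" "j < n" "\<sigma> ^^ j = \<tau> \<circ> \<sigma> ^^ i"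
      by auto
    have "\<tau> = \<tau> \<circ> (\<sigma> ^^ i \<circ> \<sigma> ^^ (n - i))"
      using ij period by (simp flip: funpow_add)
    also have "\<dots> = \<sigma> ^^ ((j + (n - i)) mod n)"
      unfolding pow_mod funpow_add ij(3) by (simp only: comp_assoc)
    finally show False
      using no mod_less_divisor[OF n_pos] by blast
  qed
  have inj: "inj_on (\<lambda>i. \<tau> \<circ> \<sigma> ^^ i) {..<n}"
    using inj_pow by (auto simp: inj_on_def fun_eq_iff)
  define c where "c = (\<lambda>f. if f \<in> ?X then - 1 else 1 :: 'a)"
  have "(\<Sum>f\<in>?X \<union> ?Y. c f * f x) = 0" for x
  proof -
    have "(\<Sum>f\<in>?X \<union> ?Y. c f * f x) = (\<Sum>f\<in>?X. c f * f x) + (\<Sum>f\<in>?Y. c f * f x)"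
      using disj by (intro sum.union_disjoint) auto
    also have "(\<Sum>f\<in>?X. c f * f x) = - (\<Sum>f\<in>?X. f x)"
      by (simp add: c_def sum_negf)
    also have "(\<Sum>f\<in>?Y. c f * f x) = (\<Sum>f\<in>?Y. f x)"
      using disj by (intro sum.cong) (auto simp: c_def)
    also have "(\<Sum>f\<in>?X. f x) = (\<Sum>i<n. (\<sigma> ^^ i) x)"
      using inj_pow by (simp add: sum.reindex)
    also have "(\<Sum>f\<in>?Y. f x) = \<tau> (\<Sum>i<n. (\<sigma> ^^ i) x)"
      using inj by (simp add: sum.reindex T.sum)
    also have "- (\<Sum>i<n. (\<sigma> ^^ i) x) + \<tau> (\<Sum>i<n. (\<sigma> ^^ i) x) = 0"
      using fixed[OF sum_pow_fixed] by simp
    finally show ?thesis .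
  qed
  moreover have "f 1 = 1 \<and> (\<forall>x y. f (x * y) = f x * f y)" if "f \<in> ?X \<union> ?Y" for f
  proof -
    from that obtain i where "f = \<sigma> ^^ i \<or> f = \<tau> \<circ> \<sigma> ^^ i" by auto
    then interpret field_aut f using pow_aut T.comp by auto
    show ?thesis by (simp add: hom)
  qed
  moreover have id: "id \<in> ?X"
    using n_pos by (intro image_eqI[of _ _ 0]) auto
  ultimately have "c id = 0"
    by (intro dedekind_independence[of "?X \<union> ?Y" c id]) blast+
  then show False
    using id by (simp add: c_def)
qed

lemma range_pow: "range (\<lambda>i. \<sigma> ^^ i) = (\<lambda>i. \<sigma> ^^ i) ` {..<n}"
proof
  show "range (\<lambda>i. \<sigma> ^^ i) \<subseteq> (\<lambda>i. \<sigma> ^^ i) ` {..<n}"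
  proof
    fix f assume "f \<in> range (\<lambda>i. \<sigma> ^^ i)"
    then obtain i where "f = \<sigma> ^^ (i mod n)"
      by (auto simp: pow_mod)
    then show "f \<in> (\<lambda>i. \<sigma> ^^ i) ` {..<n}"
      using n_pos by auto
  qed
qed auto

text \<open>By \<open>aut_is_pow\<close> in both directions each automorphism is a power of the
  other, so they generate the same cyclic group.\<close>

lemma range_pow_eq:
  assumes "cyclic_aut \<tau> d" and "\<And>x. \<tau> x = x \<longleftrightarrow> \<sigma> x = x"
  shows "range (\<lambda>i. \<tau> ^^ i) = range (\<lambda>i. \<sigma> ^^ i)"
proof -
  interpret T: cyclic_aut \<tau> d by fact
  obtain j where j: "\<tau> = \<sigma> ^^ j"
    using aut_is_pow[of \<tau>] assms T.field_aut_axioms by auto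
  obtain i where i: "\<sigma> = \<tau> ^^ i"
    using T.aut_is_pow[of \<sigma>] assms field_aut_axioms by auto
  have "\<tau> ^^ l \<in> range (\<lambda>i. \<sigma> ^^ i)" for l
  proof -
    have "\<tau> ^^ l = \<sigma> ^^ (j * l)"
      by (simp only: j funpow_mult)
    then show ?thesis by (rule range_eqI)
  qed
  moreover have "\<sigma> ^^ l \<in> range (\<lambda>i. \<tau> ^^ i)" for l
  proof -
    have "\<sigma> ^^ l = \<tau> ^^ (i * l)"
      by (subst i) (simp only: funpow_mult)
    then show ?thesis by (rule range_eqI)
  qed
  ultimately show ?thesis
    by blast
qed

text \<open>The order of an automorphism is the size of the group it generates, and that group
  depends only on the fixed field.\<close>

lemma cyclic_aut_same_fixed:
  assumes "field_aut \<tau>" and "\<And>x. \<tau> x = x \<longleftrightarrow> \<sigma> x = x"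
  shows "cyclic_aut \<tau> n"
proof -
  obtain d where d: "cyclic_aut \<tau> d"
    using cyclic_aut_exists assms(1) by blast
  interpret T: cyclic_aut \<tau> d by fact
  have "d = card (range (\<lambda>i. \<tau> ^^ i))"
    unfolding T.range_pow by (simp add: card_image T.inj_pow)
  also have "\<dots> = n"
    unfolding range_pow_eq[OF d assms(2)] range_pow by (simp add: card_image inj_pow)
  finally show ?thesis
    using d by simp
qed

section \<open>Norms, Hilbert 90 and the inversion of x - c \<sigma>(x)\<close>

definition norm :: "'a \<Rightarrow> 'a" where
  "norm x = (\<Prod>i<n. (\<sigma> ^^ i) x)"

lemma norm_mult: "norm (x * y) = norm x * norm y"
  by (simp add: norm_def field_aut.mult[OF pow_aut] prod.distrib)

lemma norm_eq_0_iff [simp]: "norm x = 0 \<longleftrightarrow> x = 0"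
  using n_pos by (auto simp: norm_def field_aut.eq_0_iff[OF pow_aut])

lemma norm_divide: "norm (x / y) = norm x / norm y"
  by (simp add: norm_def field_aut.divide[OF pow_aut] prod_dividef)

lemma norm_minus: "odd n \<Longrightarrow> norm (- x) = - norm x"
  by (simp add: norm_def field_aut.minus[OF pow_aut] prod_uminus)

text \<open>The norm is a product over the generated group and hence does not depend on the
  generator.\<close>

lemma norm_same_fixed:
  assumes "cyclic_aut \<tau> n" and "\<And>x. \<tau> x = x \<longleftrightarrow> \<sigma> x = x"
  shows "cyclic_aut.norm \<tau> n x = norm x"
proof -
  interpret T: cyclic_aut \<tau> n by fact
  have "T.norm x = (\<Prod>f\<in>range (\<lambda>i. \<tau> ^^ i). f x)"
    unfolding T.range_pow T.norm_def by (simp add: prod.reindex T.inj_pow)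
  also have "\<dots> = norm x"
    unfolding range_pow_eq[OF assms] range_pow norm_def by (simp add: prod.reindex inj_pow)
  finally show ?thesis .
qed

lemma norm_aut: "norm (\<sigma> x) = norm x"
proof (cases "x = 0")
  case False
  have "x * norm (\<sigma> x) = (\<Prod>i<Suc n. (\<sigma> ^^ i) x)"
    by (simp add: norm_def prod.lessThan_Suc_shift funpow_swap1 del: prod.lessThan_Suc)
  also have "\<dots> = x * norm x"
    by (simp add: norm_def period)
  finally show ?thesis
    using False by simp
qed simp

lemma norm_pow: "norm ((\<sigma> ^^ i) x) = norm x"
  by (induction i) (auto simp: norm_aut)

text \<open>These are the coefficients of the resolvent in Hilbert 90.\<close>

definition partial_norm :: "'a \<Rightarrow> nat \<Rightarrow> 'a" where
  "partial_norm c i = (\<Prod>j<i. (\<sigma> ^^ j) c)"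

lemma partial_norm_0 [simp]: "partial_norm c 0 = 1"
  by (simp add: partial_norm_def)

lemma partial_norm_n: "partial_norm c n = norm c"
  by (simp add: partial_norm_def norm_def)

lemma partial_norm_Suc: "partial_norm c (Suc i) = c * \<sigma> (partial_norm c i)"
proof -
  have "\<sigma> (partial_norm c i) = (\<Prod>j<i. (\<sigma> ^^ Suc j) c)"
    unfolding partial_norm_def by (induction i) (auto simp: mult)
  then show ?thesis
    by (simp add: partial_norm_def prod.lessThan_Suc_shift del: prod.lessThan_Suc)
qed

lemma partial_norm_eq_0_iff: "c \<noteq> 0 \<Longrightarrow> partial_norm c i \<noteq> 0"
  by (auto simp: partial_norm_def field_aut.eq_0_iff[OF pow_aut])

text \<open>Applying c \<sigma> moves each summand of the resolvent to the next, so the difference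
  telescopes. For norm 1 the resolvent is fixed by c \<sigma>; for other norms it inverts x - c
  \<sigma>(x) up to a nonzero factor.\<close>

lemma lin_partial_norm:
  "lin (partial_norm c) x - c * \<sigma> (lin (partial_norm c) x) = (1 - norm c) * x"
proof -
  have "c * \<sigma> (lin (partial_norm c) x) + x =
          (\<Sum>i<Suc n. partial_norm c i * (\<sigma> ^^ i) x)"
    by (simp add: lin_def sum mult sum_distrib_left partial_norm_Suc mult.assoc
        sum.lessThan_Suc_shift del: sum.lessThan_Suc)
  also have "\<dots> = lin (partial_norm c) x + norm c * x"
    by (simp add: lin_def partial_norm_n period)
  finally show ?thesis
    by (simp add: algebra_simps)
qed

lemma hilbert90:
  assumes "norm c = 1"
  obtains z where "z \<noteq> 0" "c * \<sigma> z = z"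
proof -
  \<comment> \<open>The resolvent cannot vanish identically, because its coefficient at the identity
    is 1.\<close>
  have ex: "\<exists>x. lin (partial_norm c) x \<noteq> 0"
  proof (rule ccontr)
    assume "\<not> ?thesis"
    then have "partial_norm c 0 = 0"
      unfolding lin_def using independent[of "partial_norm c" 0] n_pos by auto
    then show False by simp
  qed
  then obtain x where "lin (partial_norm c) x \<noteq> 0" ..
  then show ?thesis
    using lin_partial_norm[of c x] assms by (intro that[of "lin (partial_norm c) x"]) auto
qed

text \<open>The denominator is an additive map with trivial kernel, by \<open>nz\<close>. Taking its
  value, up to a factor, as the new variable turns the fraction into \<open>lin b x / x\<close>. The
  shape of \<open>b\<close> depends on whether the denominator has one term or two. \<open>F\<close>
  is arbitrary so that different power sums can be compared.\<close>

lemma sum_fraction_as_lin: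
  fixes w1 w2 v1 v2 :: 'a
  assumes n: "n \<ge> 2" and det: "w1 * v2 - w2 * v1 \<noteq> 0"
    and nz: "\<And>c. c \<noteq> 0 \<Longrightarrow> w1 * c + v1 * \<sigma> c \<noteq> 0"
  obtains b where
    "\<And>F :: 'a \<Rightarrow> 'a. (\<Sum>c\<in>-{0}. F ((w2 * c + v2 * \<sigma> c) / (w1 * c + v1 * \<sigma> c))) =
                       (\<Sum>x\<in>-{0}. F (lin b x / x))"
    and "(\<exists>l. \<forall>i. 0 < i \<and> i < n \<and> i \<noteq> l \<longrightarrow> b i = 0) \<or> (\<forall>i. 0 < i \<and> i < n \<longrightarrow> b i \<noteq> 0)"
proof -
  consider "v1 = 0" | "v1 \<noteq> 0" "w1 = 0" | "v1 \<noteq> 0" "w1 \<noteq> 0" by blast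
  then show ?thesis
  proof cases
    case 1
    define b where "b = (\<lambda>i::nat. if i = 0 then w2 / w1 else if i = 1 then v2 / w1 else 0)"
    have "lin b x = (\<Sum>i<n. (if i = 0 then b 0 * x else 0) + (if i = 1 then b 1 * \<sigma> x else 0))" for x
      unfolding lin_def by (intro sum.cong) (auto simp: b_def)
    then have lin: "lin b x = b 0 * x + b 1 * \<sigma> x" for x
      using n by (simp add: sum.distrib)
    have "(w2 * x + v2 * \<sigma> x) / (w1 * x + v1 * \<sigma> x) = lin b x / x" if "x \<noteq> 0" for x
      unfolding lin using 1 det that by (simp add: b_def field_simps)
    then show ?thesis
      by (intro that[of b]) (auto simp: b_def intro!: sum.cong)
  next
    case 2
    \<comment> \<open>Here the new variable is \<sigma>(c); the exponent n - 1 stands for the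
      inverse of \<sigma>.\<close>
    define b where "b = (\<lambda>i::nat. if i = 0 then v2 / v1 else if i = n - 1 then w2 / v1 else 0)"
    have "lin b x = (\<Sum>i<n. (if i = 0 then b 0 * x else 0) + (if i = n - 1 then b (n - 1) * (\<sigma> ^^ (n - 1)) x else 0))" for x
      unfolding lin_def using n by (intro sum.cong) (auto simp: b_def)
    then have lin: "lin b x = b 0 * x + b (n - 1) * (\<sigma> ^^ (n - 1)) x" for x
      using n by (simp add: sum.distrib)
    have inv: "(\<sigma> ^^ (n - 1)) (\<sigma> x) = x" "\<sigma> ((\<sigma> ^^ (n - 1)) x) = x" for x
    proof -
      have "(\<sigma> ^^ Suc (n - 1)) x = x"
        using period n by simp
      then show "\<sigma> ((\<sigma> ^^ (n - 1)) x) = x"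
        by (simp only: funpow.simps comp_apply)
      then show "(\<sigma> ^^ (n - 1)) (\<sigma> x) = x"
        by (simp only: funpow_swap1)
    qed
    have value_eq: "lin b (\<sigma> x) / \<sigma> x = (w2 * x + v2 * \<sigma> x) / (w1 * x + v1 * \<sigma> x)" if "x \<noteq> 0" for x
      unfolding lin inv using 2 n that by (simp add: b_def field_simps)
    have "(\<Sum>c\<in>-{0}. F ((w2 * c + v2 * \<sigma> c) / (w1 * c + v1 * \<sigma> c))) = (\<Sum>x\<in>-{0}. F (lin b x / x))"
      for F :: "'a \<Rightarrow> 'a"
    proof (rule sum.reindex_bij_witness[of _ "\<sigma> ^^ (n - 1)" \<sigma>])
      fix x :: 'a assume "x \<in> - {0}"
      then have x: "x \<noteq> 0"
        by simp
      then show "(\<sigma> ^^ (n - 1)) x \<in> - {0}"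
        by (simp only: Compl_iff singleton_iff field_aut.eq_0_iff[OF pow_aut] not_False_eq_True)
      show "F (lin b (\<sigma> x) / \<sigma> x) = F ((w2 * x + v2 * \<sigma> x) / (w1 * x + v1 * \<sigma> x))"
        using arg_cong[OF value_eq[OF x], of F] .
    qed (simp_all only: inv Compl_iff singleton_iff eq_0_iff not_False_eq_True)
    then show ?thesis
      by (intro that[of b]) (auto simp: b_def)
  next
    case 3
    \<comment> \<open>With this c the denominator is w1 (x - c \<sigma>(x)), so the resolvent
      \<open>?G\<close> inverts it up to the factor \<open>d\<close> below.\<close>
    define c where "c = - v1 / w1"
    let ?h = "\<lambda>x. w1 * x + v1 * \<sigma> x" and ?G = "lin (partial_norm c)"
    have h: "?h x = w1 * (x - c * \<sigma> x)" for x
      using 3 by (simp add: c_def algebra_simps)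
    \<comment> \<open>For norm 1, Hilbert 90 would give a nonzero zero of the denominator.\<close>
    have "norm c \<noteq> 1"
    proof
      assume "norm c = 1"
      then obtain z where "z \<noteq> 0" "c * \<sigma> z = z"
        by (rule hilbert90)
      then show False
        using nz[of z] by (simp add: h)
    qed
    define d where "d = w1 * (1 - norm c)"
    have d: "d \<noteq> 0"
      using 3 \<open>norm c \<noteq> 1\<close> by (simp add: d_def)
    have hG: "?h (?G x) = d * x" for x
      by (simp only: h lin_partial_norm d_def mult.assoc)
    have hinj: "x = y" if "?h x = ?h y" for x y
      using nz[of "x - y"] that by (auto simp: diff algebra_simps)
    have Gh: "?G (?h x / d) = x" for x
    proof (rule hinj)
      show "?h (?G (?h x / d)) = ?h x"
        unfolding hG using d by simp
    qed
    \<comment> \<open>The numerator is v2 / v1 times the denominator plus a multiple of its argument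
      g = \<open>?G x\<close>. Dividing by the denominator, which equals d x, leaves v2 / v1 + e g /
      x.\<close>
    define e where "e = (w2 * v1 - v2 * w1) / (v1 * d)"
    have e: "e \<noteq> 0"
      using det 3 d by (auto simp: e_def mult.commute)
    define b where "b = (\<lambda>i::nat. e * partial_norm c i + (if i = 0 then v2 / v1 else 0))"
    have lin: "lin b x = e * ?G x + v2 / v1 * x" for x
    proof -
      have "lin b x = (\<Sum>i<n. e * (partial_norm c i * (\<sigma> ^^ i) x) + (if i = 0 then v2 / v1 * x else 0))"
        unfolding lin_def by (intro sum.cong) (auto simp: b_def algebra_simps)
      then show ?thesis
        using n by (simp add: lin_def sum.distrib sum_distrib_left)
    qed
    have value_eq: "(w2 * ?G x + v2 * \<sigma> (?G x)) / ?h (?G x) = lin b x / x" if "x \<noteq> 0" for x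
    proof -
      have "d * e * v1 = w2 * v1 - v2 * w1"
        using 3 d by (simp add: e_def)
      moreover define g s where "g = ?G x" and "s = \<sigma> g"
      moreover have h: "w1 * g + v1 * s = d * x"
        using hG[of x] by (simp add: g_def s_def)
      ultimately have "(w2 * g + v2 * s) * v1 = d * (e * g * v1 + v2 * x)"
        by algebra
      also have "\<dots> = d * (e * g + v2 / v1 * x) * v1"
        using 3 by (simp add: algebra_simps)
      finally have "w2 * g + v2 * s = d * (e * g + v2 / v1 * x)"
        using 3 by simp
      then have "(w2 * g + v2 * s) / (w1 * g + v1 * s) = (e * g + v2 / v1 * x) / x"
        unfolding h using d by simp
      then show ?thesis
        by (simp add: g_def s_def lin)
    qed
    have "(\<Sum>c\<in>-{0}. F ((w2 * c + v2 * \<sigma> c) / (w1 * c + v1 * \<sigma> c))) = (\<Sum>x\<in>-{0}. F (lin b x / x))"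
      for F :: "'a \<Rightarrow> 'a"
    proof (rule sum.reindex_bij_witness[of _ ?G "\<lambda>x. ?h x / d"])
      fix x :: 'a assume "x \<in> - {0}"
      then show "?h x / d \<in> - {0}"
        using nz d by simp
      show "F (lin b (?h x / d) / (?h x / d)) = F ((w2 * x + v2 * \<sigma> x) / ?h x)"
        using value_eq[of "?h x / d"] \<open>?h x / d \<in> - {0}\<close> by (simp add: Gh)
    next
      fix x :: 'a assume "x \<in> - {0}"
      then show "?G x \<in> - {0}"
        using hG[of x] d by auto
    qed (use hG Gh d in auto)
    \<comment> \<open>Away from index 0 the coefficients are nonzero multiples of partial norms,
      which gives the second alternative.\<close>
    moreover have "b i \<noteq> 0" if "0 < i" for i
      using that e 3 partial_norm_eq_0_iff[of c i] by (simp add: b_def c_def)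
    ultimately show ?thesis
      by (intro that[of b]) auto
  qed
qed

text \<open>Write the fractions as \<open>lin b x / x\<close>. The power sums force b to have two
  nonzero coefficients with positive index, and also a zero one. Neither shape allowed by
  \<open>sum_fraction_as_lin\<close> has both properties.\<close>

lemma binomial_sum_not_fraction_sum:
  assumes n: "n \<ge> 4" and two: "(2::'a) \<noteq> 0" and m: "0 < m" "m < n" "m \<noteq> n - m"
    and ab: "\<alpha> \<noteq> 0" "\<beta> \<noteq> 0" and det: "w1 * v2 - w2 * v1 \<noteq> 0"
    and nz: "\<And>c. c \<noteq> 0 \<Longrightarrow> w1 * c + v1 * \<sigma> c \<noteq> 0"
    and eq: "\<And>F :: 'a \<Rightarrow> 'a.
      (\<Sum>x\<in>-{0}. F ((\<alpha> * (\<sigma> ^^ m) x + \<beta> * (\<sigma> ^^ (n - m)) x) / x)) =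
      (\<Sum>c\<in>-{0}. F ((w2 * c + v2 * \<sigma> c) / (w1 * c + v1 * \<sigma> c)))"
  shows False
proof -
  obtain b where b:
    "\<And>F :: 'a \<Rightarrow> 'a. (\<Sum>c\<in>-{0}. F ((w2 * c + v2 * \<sigma> c) / (w1 * c + v1 * \<sigma> c))) =
                       (\<Sum>x\<in>-{0}. F (lin b x / x))"
    and alt: "(\<exists>l. \<forall>i. 0 < i \<and> i < n \<and> i \<noteq> l \<longrightarrow> b i = 0) \<or> (\<forall>i. 0 < i \<and> i < n \<longrightarrow> b i \<noteq> 0)"
    by (rule sum_fraction_as_lin[of w1 v2 w2 v1]) (use n det nz in auto)
  define a where "a = (\<lambda>i::nat. if i = m then \<alpha> else if i = n - m then \<beta> else 0)"
  have "lin a x = (\<Sum>i<n. (if i = m then \<alpha> * (\<sigma> ^^ m) x else 0)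
      + (if i = n - m then \<beta> * (\<sigma> ^^ (n - m)) x else 0))" for x
    unfolding lin_def using m by (intro sum.cong) (auto simp: a_def)
  then have lin: "lin a x = \<alpha> * (\<sigma> ^^ m) x + \<beta> * (\<sigma> ^^ (n - m)) x" for x
    using m by (simp add: sum.distrib)
  have ab_eq: "(\<Sum>x\<in>-{0}. F (lin a x / x)) = (\<Sum>x\<in>-{0}. F (lin b x / x))" for F :: "'a \<Rightarrow> 'a"
    using eq[of F] b[of F] by (simp add: lin)
  have "a 0 = b 0"
    using ab_eq[of "\<lambda>x. x"] by (simp add: sum_lin_over_id)
  then have b0: "b 0 = 0"
    using m by (simp add: a_def)
  \<comment> \<open>Since both constant coefficients are 0, the twisted quadratic power sums compare
    exactly these products.\<close>
  have prod: "a k * (\<sigma> ^^ k) (a (n - k)) = b k * (\<sigma> ^^ k) (b (n - k))" if "0 < k" "k < n" for k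
    using ab_eq[of "\<lambda>x. x * (\<sigma> ^^ k) x"] sum_lin_mult_pow[OF that two, of a]
      sum_lin_mult_pow[OF that two, of b] b0 \<open>a 0 = b 0\<close> by simp
  have "b m \<noteq> 0 \<and> b (n - m) \<noteq> 0"
    using prod[of m] m ab
    by (auto simp: a_def field_aut.eq_0_iff[OF pow_aut] field_aut.zero[OF pow_aut])
  moreover have "\<exists>i. 0 < i \<and> i < n \<and> b i = 0"
  proof -
    \<comment> \<open>As n is at least 4, some positive index is neither m nor n - m; there the
      product for the binomial is 0.\<close>
    have "card {1..<n} > card {m, n - m}"
      using n card_insert_le_m1[of 2 "{n - m}" m] by auto
    then obtain k where k: "k \<in> {1..<n}" "k \<notin> {m, n - m}"
      by (meson card_mono finite.emptyI finite_insert linorder_not_less subsetI)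
    then have "b k = 0 \<or> b (n - k) = 0"
      using prod[of k] by (auto simp: a_def field_aut.eq_0_iff[OF pow_aut])
    with k show ?thesis
      by (auto intro: exI[of _ k] exI[of _ "n - k"])
  qed
  moreover have "0 < n - m" "n - m < n"
    using m by auto
  ultimately show False
    using alt m by metis
qed

end

subsection \<open>Finite field extensions and dimensions by counting\<close>

text \<open>Coordinates with respect to a basis are unique. Restricting them to the basis, via
  \<open>PiE\<close>, makes them a finite set that can be counted. Dimensions are read off from
  cardinalities below.\<close>

lemma card_eq_power_dim:
  fixes scale :: "'k::{field,finite} \<Rightarrow> 'b::ab_group_add \<Rightarrow> 'b"
  assumes "vector_space scale" and S: "module.subspace scale S" "finite S"
  shows "card S = CARD('k) ^ vector_space.dim scale S"
proof -
  interpret vector_space scale by fact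
  obtain B where B: "B \<subseteq> S" "independent B" "S \<subseteq> span B" "card B = dim S"
    using basis_exists by blast
  have "finite B"
    using B(1) S(2) by (rule finite_subset)
  let ?f = "\<lambda>u. \<Sum>b\<in>B. scale (u b) b"
  have "S = span B"
    using B S(1) by (simp add: span_minimal subset_antisym)
  also have "\<dots> = ?f ` (PiE B (\<lambda>_. UNIV))"
  proof
    show "span B \<subseteq> ?f ` (PiE B (\<lambda>_. UNIV))"
    proof
      fix v assume "v \<in> span B"
      then obtain u where "v = ?f u"
        using span_finite[OF \<open>finite B\<close>] by auto
      also have "\<dots> = ?f (restrict u B)"
        by (intro sum.cong) auto
      finally show "v \<in> ?f ` (PiE B (\<lambda>_. UNIV))"
        by (intro image_eqI[of v ?f "restrict u B"]) auto
    qed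
    show "?f ` (PiE B (\<lambda>_. UNIV)) \<subseteq> span B"
      by (auto intro: span_sum span_scale span_base)
  qed
  finally have "card S = card (?f ` (PiE B (\<lambda>_. UNIV)))"
    by simp
  also have "inj_on ?f (PiE B (\<lambda>_. UNIV))"
  proof (rule inj_onI)
    fix u v assume uv: "u \<in> PiE B (\<lambda>_. UNIV)" "v \<in> PiE B (\<lambda>_. UNIV)" "?f u = ?f v"
    have "(\<Sum>b\<in>B. scale (u b - v b) b) = 0"
      using uv(3) by (simp add: scale_left_diff_distrib sum_subtractf)
    then have "u b = v b" if "b \<in> B" for b
      using independentD[OF B(2) \<open>finite B\<close> order_refl, of "\<lambda>b. u b - v b" b] that by simp
    with uv show "u = v"
      by (intro PiE_ext) auto
  qed
  then have "card (?f ` (PiE B (\<lambda>_. UNIV))) = card (PiE B (\<lambda>_. UNIV :: 'k set))"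
    by (rule card_image)
  also have "\<dots> = CARD('k) ^ dim S"
    using \<open>finite B\<close> B(4) by (simp add: card_PiE)
  finally show ?thesis .
qed

lemma is_line_iff_card:
  fixes W :: "('a::{field,finite} ^ 4) set"
  shows "is_line W \<longleftrightarrow> vec.subspace W \<and> card W = CARD('a) ^ 2"
proof -
  have "CARD('a) > 1"
    using card_mono[of "UNIV :: 'a set" "{0, 1}"] by simp
  then have "vec.dim W = 2 \<longleftrightarrow> card W = CARD('a) ^ 2" if "vec.subspace W"
    using card_eq_power_dim[OF vec.vector_space_axioms that] by simp
  then show ?thesis
    unfolding is_line_def by blast
qed

lemma is_line_eq:
  fixes W :: "('a::{field,finite} ^ 4) set"
  assumes "is_line W" "is_line W'" "W \<subseteq> W'"
  shows "W = W'"
  using assms by (intro card_subset_eq) (auto simp: is_line_iff_card)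

text \<open>The elements counted are roots of the nonzero polynomial X^m - X.\<close>

lemma card_power_eq_le:
  assumes "m > 1"
  shows "card {x :: 'a::field. x ^ m = x} \<le> m"
proof -
  let ?p = "Polynomial.monom 1 m - [:0, 1 :: 'a:]"
  have "coeff ?p m = 1"
    using assms by (auto simp: coeff_pCons split: nat.split)
  then have "?p \<noteq> 0"
    by (metis coeff_0 zero_neq_one)
  moreover have "degree ?p \<le> m"
    using assms by (intro degree_diff_le) (auto simp: degree_monom_eq)
  ultimately show ?thesis
    using card_poly_roots_bound[of ?p] by (simp add: poly_monom)
qed

section \<open>The extension of finite fields and its Frobenius automorphism\<close>

locale finite_field_ext =
  fixes \<iota> :: "'k::{field,finite} \<Rightarrow> 'a::{field,finite}" and q n :: nat
  assumes q_primepow: "primepow q" and q_odd: "odd q" and n_odd: "odd n"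
    and card_k: "CARD('k) = q" and card_a: "CARD('a) = q ^ n" and emb: "field_embedding \<iota>"
begin

lemma emb_1 [simp]: "\<iota> 1 = 1"
  and emb_add: "\<iota> (x + y) = \<iota> x + \<iota> y"
  and emb_mult: "\<iota> (x * y) = \<iota> x * \<iota> y"
  using emb by (auto simp: field_embedding_def)

lemma emb_0 [simp]: "\<iota> 0 = 0"
  by (metis emb_add add_cancel_left_left)

lemma emb_diff: "\<iota> (x - y) = \<iota> x - \<iota> y"
  by (metis emb_add add_diff_cancel_right' diff_add_cancel)

lemma emb_eq_0_iff [simp]: "\<iota> x = 0 \<longleftrightarrow> x = 0"
  by (metis emb_0 emb_1 emb_mult mult_zero_left right_inverse zero_neq_one)

lemma emb_eq_iff [simp]: "\<iota> x = \<iota> y \<longleftrightarrow> x = y"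
  by (metis emb_diff emb_eq_0_iff eq_iff_diff_eq_0)

lemma emb_power: "\<iota> (x ^ i) = \<iota> x ^ i"
  by (induction i) (auto simp: emb_mult)

lemma q_gt_1: "q > 1"
  using q_primepow primepow_gt_Suc_0 by auto

lemma n_gt_0: "n > 0"
  using n_odd by (cases n) auto

lemma card_range: "card (range \<iota>) = q"
  using card_image[of \<iota> UNIV] card_k by (simp add: inj_def)

text \<open>The odd number q^n is 0 in the field; if 2 were 0 as well, then 1 would be 0.\<close>

lemma two_neq_0: "(2::'a) \<noteq> 0"
proof
  assume "(2::'a) = 0"
  have "odd (q ^ n)"
    using q_odd by simp
  then obtain k where k: "q ^ n = 2 * k + 1"
    by (rule oddE)
  have "(of_nat (q ^ n) :: 'a) = of_nat (2 * k + 1)"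
    by (simp only: k)
  then have "(of_nat (q ^ n) :: 'a) = 1"
    using \<open>(2::'a) = 0\<close> by simp
  then show False
    using of_nat_CARD_eq_0[where 'a='a] card_a by simp
qed

definition frobenius :: "'a \<Rightarrow> 'a" where
  "frobenius x = x ^ q"

lemma funpow_frobenius: "(frobenius ^^ i) x = x ^ (q ^ i)"
  by (induction i) (auto simp: frobenius_def mult.commute simp flip: power_mult)

text \<open>The image of the embedding consists of roots of X^q - X and has q elements, which is the
  maximal number of roots.\<close>

lemma frobenius_fixed_iff: "frobenius x = x \<longleftrightarrow> x \<in> range \<iota>"
proof -
  have "range \<iota> \<subseteq> {x. frobenius x = x}"
    using finite_field_power_CARD[where 'a='k] card_k
    by (auto simp: frobenius_def simp flip: emb_power)
  moreover have "card {x. frobenius x = x} \<le> card (range \<iota>)"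
    using card_power_eq_le[OF q_gt_1, where 'a='a] by (simp add: frobenius_def card_range)
  ultimately have "range \<iota> = {x. frobenius x = x}"
    by (intro card_seteq) auto
  then show ?thesis
    by blast
qed

text \<open>The prime below q is 0 in the field, so it is the characteristic, and the binomial
  formula collapses for powers of it.\<close>

lemma frobenius_add: "frobenius (x + y) = frobenius x + frobenius y"
proof -
  have CHAR: "prime CHAR('a)"
    by (rule prime_CHAR_semidom) (rule finite_imp_CHAR_pos, simp)
  obtain p e where p: "prime p" "e > 0" "q = p ^ e"
    using q_primepow by (auto simp: primepow_def)
  have "(of_nat (q ^ n) :: 'a) = 0"
    using of_nat_CARD_eq_0[where 'a='a] card_a by simp
  then have "(of_nat p :: 'a) = 0"
    by (simp add: p split: if_splits)
  then have "CHAR('a) dvd p"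
    by (simp add: of_nat_eq_0_iff_char_dvd)
  then have "CHAR('a) = p"
    using CHAR p(1) by (simp add: primes_dvd_imp_eq)
  then show ?thesis
    unfolding frobenius_def using CHAR p(3) by (simp add: freshmans_dream')
qed

lemma frobenius_period: "frobenius ^^ n = id"
  using finite_field_power_CARD[where 'a='a] by (simp add: fun_eq_iff funpow_frobenius card_a)

lemma bij_frobenius: "bij frobenius"
proof (rule o_bij)
  show "(frobenius ^^ (n - 1)) \<circ> frobenius = id"
    using frobenius_period n_gt_0 by (metis Suc_diff_1 funpow_Suc_right)
  show "frobenius \<circ> (frobenius ^^ (n - 1)) = id"
    using frobenius_period n_gt_0 by (metis Suc_diff_1 funpow.simps(2))
qed

sublocale frob: field_aut frobenius
proof unfold_locales
  show "field_automorphism frobenius"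
    by (simp add: field_automorphism_def field_embedding_def bij_frobenius frobenius_add)
      (simp add: frobenius_def power_mult_distrib)
qed

sublocale frob: cyclic_aut frobenius n
proof unfold_locales
  show "inj_on (\<lambda>i. frobenius ^^ i) {..<n}"
  proof (rule frob.inj_on_pow_lessThan)
    fix d assume d: "0 < d" "d < n"
    show "frobenius ^^ d \<noteq> id"
    proof
      \<comment> \<open>Then all q^n elements would be roots of a polynomial of degree q^d, which is
        too small.\<close>
      assume "frobenius ^^ d = id"
      then have "{x :: 'a. x ^ (q ^ d) = x} = UNIV"
        by (auto simp: fun_eq_iff funpow_frobenius)
      then have "q ^ n \<le> q ^ d"
        using card_power_eq_le[OF one_less_power[OF q_gt_1 d(1)], where 'a='a] card_a by simp
      then show False
        using power_strict_increasing[OF d(2) q_gt_1] by (meson not_le)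
    qed
  qed
qed (use n_gt_0 frobenius_period in auto)

lemma field_norm_eq: "field_norm q n x = frob.norm x"
  by (simp add: field_norm_def frob.norm_def funpow_frobenius)

text \<open>By Bezout some power of \<open>frobenius ^^ m\<close> has exponent 1 modulo n, so a
  fixed element is already fixed by Frobenius. If m = 0, coprimality forces n = 1.\<close>

lemma frobenius_pow_fixed_iff:
  assumes "coprime m n"
  shows "(frobenius ^^ m) x = x \<longleftrightarrow> x \<in> range \<iota>"
proof
  assume fixed: "(frobenius ^^ m) x = x"
  interpret M: field_aut "frobenius ^^ m" by (rule frob.pow_aut)
  show "x \<in> range \<iota>"
  proof (cases "m = 0")
    case True
    then have "n = 1" using assms by simp
    then show ?thesis
      using frobenius_period by (simp flip: frobenius_fixed_iff)
  next
    case False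
    obtain u v where uv: "m * u = n * v + 1"
      using bezout_nat[OF False, of n] assms by auto
    have "(frobenius ^^ (n * v + 1)) x = x"
      using M.funpow_fixed[OF fixed, of u] by (simp only: funpow_mult uv)
    then have "(frobenius ^^ ((n * v + 1) mod n)) x = x"
      by (simp only: frob.pow_mod)
    moreover have "(n * v + 1) mod n = 1 mod n"
      by (simp only: mod_mult_self4)
    ultimately have "(frobenius ^^ 1) x = x"
      by (simp only: frob.pow_mod)
    then show ?thesis
      by (simp flip: frobenius_fixed_iff)
  qed
qed (simp add: frob.funpow_fixed frobenius_fixed_iff)

lemma frobenius_pow_cyclic:
  assumes "coprime m n"
  shows "cyclic_aut (frobenius ^^ m) n"
    and "cyclic_aut.norm (frobenius ^^ m) n x = frob.norm x"
proof -
  show *: "cyclic_aut (frobenius ^^ m) n"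
    by (rule frob.cyclic_aut_same_fixed)
      (auto simp: frobenius_pow_fixed_iff assms frobenius_fixed_iff frob.pow_aut)
  show "cyclic_aut.norm (frobenius ^^ m) n x = frob.norm x"
    by (rule frob.norm_same_fixed[OF *])
      (auto simp: frobenius_pow_fixed_iff assms frobenius_fixed_iff)
qed

lemma vector_space_subscale: "vector_space (subscale \<iota>)"
  by unfold_locales (simp_all add: subscale_def vec_eq_iff emb_add emb_mult algebra_simps)

sublocale sub: vector_space "subscale \<iota>"
  by (rule vector_space_subscale)

lemma card_eq_power_sub_dim: "sub.subspace S \<Longrightarrow> card S = q ^ sub_dim \<iota> S"
  using card_eq_power_dim[OF vector_space_subscale] card_k by simp

lemma sub_dim_eq_iff: "sub.subspace S \<Longrightarrow> sub_dim \<iota> S = d \<longleftrightarrow> card S = q ^ d"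
  using q_gt_1 by (simp add: card_eq_power_sub_dim)

lemma sub_subspaceI:
  assumes "0 \<in> S" "\<And>u v. u \<in> S \<Longrightarrow> v \<in> S \<Longrightarrow> u + v \<in> S"
    and "\<And>c u. u \<in> S \<Longrightarrow> \<iota> c *s u \<in> S"
  shows "sub.subspace S"
  using assms by (auto simp: sub.subspace_def subscale_def)

lemma vec_subspace_imp_sub_subspace: "vec.subspace W \<Longrightarrow> sub.subspace W"
  by (auto simp: vec.subspace_def intro: sub_subspaceI)

lemma weight_eq_iff:
  assumes "sub.subspace U" "vec.subspace W"
  shows "weight \<iota> U W = d \<longleftrightarrow> card (W \<inter> U) = q ^ d"
  unfolding weight_def
  by (intro sub_dim_eq_iff sub.subspace_inter vec_subspace_imp_sub_subspace assms)

end

subsection \<open>The subspace defining the linear set\<close>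

lemma vector_4_nth [simp]:
  "(vector [x1, x2, x3, x4] :: 'a::zero ^ 4) $ 1 = x1"
  "(vector [x1, x2, x3, x4] :: 'a::zero ^ 4) $ 2 = x2"
  "(vector [x1, x2, x3, x4] :: 'a::zero ^ 4) $ 3 = x3"
  "(vector [x1, x2, x3, x4] :: 'a::zero ^ 4) $ 4 = x4"
  by (simp_all add: vector_def)

lemma vec4_eq_iff: "(v :: 'a ^ 4) = w \<longleftrightarrow> v $ 1 = w $ 1 \<and> v $ 2 = w $ 2 \<and> v $ 3 = w $ 3 \<and> v $ 4 = w $ 4"
  by (simp add: vec_eq_iff forall_4)

locale D_A_set = finite_field_ext \<iota> q n
  for \<iota> :: "'k::{field,finite} \<Rightarrow> 'a::{field,finite}" and q n :: nat +
  fixes r :: int and a :: 'a and \<xi> :: 'k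
  assumes n_ge_3: "n \<ge> 3" and coprime_r: "coprime (int n) r"
    and a_nz: "a \<noteq> 0" and norm_a: "frob.norm a \<noteq> 1" and \<xi>_nz: "\<xi> \<noteq> 0"
begin

definition m :: nat where "m = nat (r mod int n)"

lemma int_m: "int m = r mod int n"
  using n_gt_0 by (simp add: m_def)

lemma coprime_m: "coprime m n"
proof -
  have "gcd (r mod int n) (int n) = gcd r (int n)"
    by (metis gcd.commute gcd_red_int)
  then have "gcd (int m) (int n) = 1"
    unfolding int_m using coprime_r by (simp add: coprime_iff_gcd_eq_1 gcd.commute)
  then show ?thesis
    by (metis coprime_int_iff coprime_iff_gcd_eq_1)
qed

lemma m_bounds: "0 < m" "m < n"
proof -
  show "m < n"
    using int_m n_gt_0 by (metis of_nat_0_less_iff of_nat_less_iff pos_mod_bound)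
  show "0 < m"
    using coprime_m n_ge_3 by (cases m) auto
qed

lemma coprime_n_m: "coprime (n - m) n"
  using coprime_m m_bounds by (metis coprime_commute coprime_diff_one_left_nat gcd_diff2_nat coprime_iff_gcd_eq_1 less_imp_le)

section \<open>The automorphism \<sigma>, its inverse \<open>\<sigma>'\<close>, and the map
  A\<close>

abbreviation \<sigma> :: "'a \<Rightarrow> 'a" where "\<sigma> \<equiv> frobenius ^^ m"
abbreviation \<sigma>' :: "'a \<Rightarrow> 'a" where "\<sigma>' \<equiv> frobenius ^^ (n - m)"

sublocale S: field_aut \<sigma> by (rule frob.pow_aut)
sublocale S': field_aut \<sigma>' by (rule frob.pow_aut)

lemma \<sigma>_inv [simp]: "\<sigma> (\<sigma>' x) = x" "\<sigma>' (\<sigma> x) = x"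
proof -
  have "\<sigma> \<circ> \<sigma>' = id" "\<sigma>' \<circ> \<sigma> = id"
    using m_bounds frobenius_period by (simp_all flip: funpow_add)
  then show "\<sigma> (\<sigma>' x) = x" "\<sigma>' (\<sigma> x) = x"
    by (simp_all add: fun_eq_iff)
qed

lemma \<sigma>_fixed_iff: "\<sigma> x = x \<longleftrightarrow> x \<in> range \<iota>" "\<sigma>' x = x \<longleftrightarrow> x \<in> range \<iota>"
  by (simp_all add: frobenius_pow_fixed_iff coprime_m coprime_n_m)

lemma \<sigma>_emb [simp]: "\<sigma> (\<iota> c) = \<iota> c" "\<sigma>' (\<iota> c) = \<iota> c"
  by (simp_all add: \<sigma>_fixed_iff)

definition A :: "'a \<Rightarrow> 'a" where "A = A_map q n a r"

text \<open>The exponent n - r is congruent to n - m modulo n, so the second term involves the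
  inverse of \<sigma>.\<close>

lemma A_eq: "A x = \<sigma> x - a * \<sigma>' x"
proof -
  have "(int n - r) mod int n = int (n - m)"
  proof -
    have "(int n - r) mod int n = (int n - int m) mod int n"
      by (simp only: int_m mod_diff_right_eq)
    also have "int n - int m = int (n - m)"
      using m_bounds by simp
    also have "int (n - m) mod int n = int (n - m)"
      using m_bounds by (intro mod_pos_pos_trivial) auto
    finally show ?thesis .
  qed
  then show ?thesis
    by (simp add: A_def A_map_def frob_def funpow_frobenius m_def)
qed

lemma A_add: "A (x + y) = A x + A y" and A_diff: "A (x - y) = A x - A y"
  by (simp_all add: A_eq S.hom S'.hom algebra_simps)

lemma A_emb: "A (\<iota> c * x) = \<iota> c * A x"
  by (simp add: A_eq S.hom S'.hom algebra_simps)

lemma A_0 [simp]: "A 0 = 0"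
  by (simp add: A_eq)

lemma norm_\<sigma> [simp]: "frob.norm (\<sigma> x) = frob.norm x" "frob.norm (\<sigma>' x) = frob.norm x"
  by (simp_all add: frob.norm_pow)

text \<open>A zero satisfies N(x) = N(a) N(x), and N(a) is not 1.\<close>

lemma A_eq_0_iff [simp]: "A x = 0 \<longleftrightarrow> x = 0"
proof
  assume "A x = 0"
  then have "\<sigma> x = a * \<sigma>' x"
    by (simp add: A_eq)
  then have "frob.norm x = frob.norm a * frob.norm x"
    by (metis norm_\<sigma> frob.norm_mult)
  with norm_a show "x = 0"
    by simp
qed simp

text \<open>A scalar keeps the vector of (x, y) in \<open>U\<close> exactly if it lies in the sets
  of both x and y, so these sets determine the weights of points.\<close>

definition stab :: "'a \<Rightarrow> 'a set" where
  "stab x = {l. A (l * x) = l * A x}"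

lemma stab_0 [simp]: "stab 0 = UNIV"
  by (simp add: stab_def)

text \<open>Expanding A(l x) - l A(x) and writing l = \<open>\<sigma> (\<sigma>' l)\<close> shows
  that l enters only through \<mu> = \<open>\<sigma>' l - l\<close>.\<close>

lemma stab_iff: "l \<in> stab x \<longleftrightarrow> \<sigma> (\<sigma>' l - l) * \<sigma> x = - a * (\<sigma>' l - l) * \<sigma>' x"
proof -
  have "A (l * x) - l * A x = - (\<sigma> (\<sigma>' l - l) * \<sigma> x - - a * (\<sigma>' l - l) * \<sigma>' x)"
    by (simp add: A_eq S.hom S'.hom algebra_simps)
  then show ?thesis
    unfolding stab_def mem_Collect_eq by (metis eq_iff_diff_eq_0 neg_equal_0_iff_equal)
qed

lemma range_subset_stab: "range \<iota> \<subseteq> stab x"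
  by (auto simp: stab_def A_emb)

lemma range_\<iota>_closed: "0 \<in> range \<iota>" "x \<in> range \<iota> \<Longrightarrow> y \<in> range \<iota> \<Longrightarrow> x / y \<in> range \<iota>"
  by (simp_all add: S.hom flip: \<sigma>_fixed_iff(1))

text \<open>Norms remove \<sigma> and its inverse from \<open>stab_iff\<close>. The minus sign
  survives as n is odd, so a nonzero \<mu> would force N(a) = -1.\<close>

lemma stab_trivial:
  assumes "frob.norm a \<noteq> -1" "x \<noteq> 0"
  shows "stab x = range \<iota>"
proof -
  have "l \<in> range \<iota>" if "l \<in> stab x" for l
  proof (rule ccontr)
    assume "l \<notin> range \<iota>"
    then have mu: "\<sigma>' l - l \<noteq> 0"
      by (simp flip: \<sigma>_fixed_iff(2))
    have "frob.norm (\<sigma> (\<sigma>' l - l) * \<sigma> x) = frob.norm (- a * (\<sigma>' l - l) * \<sigma>' x)"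
      using that by (simp only: stab_iff)
    then have "frob.norm (\<sigma>' l - l) * frob.norm x = - frob.norm a * frob.norm (\<sigma>' l - l) * frob.norm x"
      by (simp only: frob.norm_mult norm_\<sigma> frob.norm_minus[OF n_odd])
    then have "(1 + frob.norm a) * (frob.norm (\<sigma>' l - l) * frob.norm x) = 0"
      by algebra
    then have "1 + frob.norm a = 0"
      using mu assms by simp
    with assms show False
      by (metis add_eq_0_iff)
  qed
  then show ?thesis
    using range_subset_stab by blast
qed

section \<open>The vectors of U and the weights of the points they span\<close>

definition pt :: "'a \<Rightarrow> 'a \<Rightarrow> 'a ^ 4" where
  "pt x y = vector [x, y, A y, \<iota> \<xi> * A x]"

definition U :: "('a ^ 4) set" where
  "U = D_A q n a r (\<iota> \<xi>)"

lemma U_eq: "U = range (\<lambda>(x, y). pt x y)"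
  by (auto simp: U_def D_A_def pt_def A_def)

lemma U_iff: "u \<in> U \<longleftrightarrow> (\<exists>x y. u = pt x y)"
  by (auto simp: U_eq)

lemma pt_in_U [simp]: "pt x y \<in> U"
  by (auto simp: U_iff)

lemma pt_eq_iff [simp]: "pt x y = pt x' y' \<longleftrightarrow> x = x' \<and> y = y'"
  by (auto simp: pt_def vec4_eq_iff)

lemma pt_eq_0_iff [simp]: "pt x y = 0 \<longleftrightarrow> x = 0 \<and> y = 0"
  by (auto simp: pt_def vec4_eq_iff)

lemma pt_add: "pt x y + pt x' y' = pt (x + x') (y + y')"
  by (simp add: pt_def vec4_eq_iff A_add algebra_simps)

lemma pt_emb: "\<iota> c *s pt x y = pt (\<iota> c * x) (\<iota> c * y)"
  by (simp add: pt_def vec4_eq_iff A_emb)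

text \<open>The first two coordinates of a vector of \<open>U\<close> determine its parameters, so
  only (l x, l y) can represent the multiple.\<close>

lemma scale_pt_in_U: "l *s pt x y \<in> U \<longleftrightarrow> l \<in> stab x \<inter> stab y"
proof -
  have "l *s pt x y \<in> U \<longleftrightarrow> l *s pt x y = pt (l * x) (l * y)"
    unfolding U_iff by (auto simp: pt_def vec4_eq_iff)
  also have "\<dots> \<longleftrightarrow> l \<in> stab x \<inter> stab y"
    using \<xi>_nz by (auto simp: pt_def vec4_eq_iff stab_def)
  finally show ?thesis .
qed

lemma subspace_U: "sub.subspace U"
proof (rule sub_subspaceI)
  show "0 \<in> U"
    unfolding U_iff by (metis pt_eq_0_iff)
qed (auto simp: U_iff pt_add pt_emb)

lemma card_U: "card U = q ^ (2 * n)"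
proof -
  have "card U = CARD('a \<times> 'a)"
    unfolding U_eq by (rule card_image) (auto simp: inj_def)
  then show ?thesis
    by (simp add: card_a power_add mult_2)
qed

lemma sub_dim_U: "sub_dim \<iota> U = 2 * n"
  by (simp add: sub_dim_eq_iff subspace_U card_U)

lemma span_Int_U:
  assumes "x \<noteq> 0 \<or> y \<noteq> 0"
  shows "vec.span {pt x y} \<inter> U = (\<lambda>l. l *s pt x y) ` (stab x \<inter> stab y)"
  by (auto simp: vec.span_singleton scale_pt_in_U)

lemma card_span_Int_U:
  assumes "x \<noteq> 0 \<or> y \<noteq> 0"
  shows "card (vec.span {pt x y} \<inter> U) = card (stab x \<inter> stab y)"
  unfolding span_Int_U[OF assms] using assms
  by (intro card_image) (auto simp: inj_on_def pt_def vec4_eq_iff)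

lemma linear_set_U: "linear_set U = {vec.span {pt x y} |x y. x \<noteq> 0 \<or> y \<noteq> 0}"
  unfolding linear_set_def by (auto simp: U_iff) (metis pt_eq_0_iff)+

lemma weight_span_pt:
  assumes "x \<noteq> 0 \<or> y \<noteq> 0"
  shows "weight \<iota> U (vec.span {pt x y}) = d \<longleftrightarrow> card (stab x \<inter> stab y) = q ^ d"
  by (simp add: weight_eq_iff subspace_U vec.subspace_span card_span_Int_U[OF assms])

lemma maximum_scattered_U:
  assumes "frob.norm a \<noteq> -1"
  shows "maximum_scattered \<iota> n U"
proof -
  have "stab x \<inter> stab y = range \<iota>" if "x \<noteq> 0 \<or> y \<noteq> 0" for x y
    using stab_trivial[OF assms] range_subset_stab that by (cases "x = 0"; cases "y = 0") auto
  then show ?thesis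
    by (auto simp: maximum_scattered_def scattered_def subspace_U sub_dim_U linear_set_U
        weight_span_pt card_range)
qed

end

subsection \<open>Points of weight two\<close>

lemma card_by_fibers:
  assumes "finite A" and "\<And>x. x \<in> A \<Longrightarrow> card {z \<in> A. f z = f x} = c"
  shows "card A = c * card (f ` A)"
proof -
  have "card A = (\<Sum>y\<in>f ` A. card {z \<in> A. f z = y})"
    using sum.image_gen[OF assms(1), of "\<lambda>_. 1 :: nat" f] by simp
  also have "\<dots> = (\<Sum>y\<in>f ` A. c)"
    using assms(2) by (intro sum.cong) auto
  finally show ?thesis
    by simp
qed

lemma span_singleton_eq_iff:
  fixes u v :: "'a::field ^ 4"
  assumes "v \<noteq> 0"
  shows "vec.span {v} = vec.span {u} \<longleftrightarrow> v \<in> vec.span {u}"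
proof
  assume "v \<in> vec.span {u}"
  then obtain c where c: "v = c *s u"
    by (auto simp: vec.span_singleton)
  with assms have "c \<noteq> 0"
    by auto
  then have "u = inverse c *s v"
    by (simp add: c)
  then have "u \<in> vec.span {v}"
    by (auto simp: vec.span_singleton)
  then show "vec.span {v} = vec.span {u}"
    using \<open>v \<in> vec.span {u}\<close> by (intro subset_antisym vec.span_minimal) auto
qed (metis vec.span_base singletonI)

context D_A_set
begin

abbreviation K :: "'a set" where "K \<equiv> range \<iota>"

lemma card_K_mult:
  assumes "x \<noteq> 0"
  shows "card ((\<lambda>\<kappa>. \<kappa> * x) ` (K - {0})) = q - 1"
proof -
  have "card ((\<lambda>\<kappa>. \<kappa> * x) ` (K - {0})) = card (K - {0})"
    using assms by (intro card_image) (auto simp: inj_on_def)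
  then show ?thesis
    using card_range range_\<iota>_closed(1) by (simp add: card_Diff_singleton)
qed

text \<open>The equation says that x is fixed by the square of \<sigma>. As n is odd, 2m is still
  coprime to n, so the square has the same fixed field.\<close>

lemma K_iff_\<sigma>_eq_\<sigma>': "x \<in> K \<longleftrightarrow> \<sigma> x = \<sigma>' x"
proof -
  have "\<sigma> x = \<sigma>' x \<longleftrightarrow> \<sigma> (\<sigma> x) = x"
    by (metis \<sigma>_inv)
  also have "\<sigma> (\<sigma> x) = (frobenius ^^ (2 * m)) x"
    by (simp add: mult_2 funpow_add)
  also have "\<dots> = x \<longleftrightarrow> x \<in> K"
    using coprime_m n_odd by (intro frobenius_pow_fixed_iff) simp
  finally show ?thesis
    by simp
qed

lemma K_diff: "x \<in> K \<Longrightarrow> y \<in> K \<Longrightarrow> x - y \<in> K"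
  by (simp add: S.diff flip: \<sigma>_fixed_iff(1))

text \<open>These classes are the fibres of both quotient maps in
  \<open>ratio_set_not_pseudoregulus\<close>.\<close>

lemma card_K_class:
  assumes "x \<noteq> 0"
  shows "card {z. z \<noteq> 0 \<and> z / x \<in> K} = q - 1"
proof -
  have "{z. z \<noteq> 0 \<and> z / x \<in> K} = (\<lambda>\<kappa>. \<kappa> * x) ` (K - {0})"
  proof (intro equalityI subsetI)
    fix z assume "z \<in> {z. z \<noteq> 0 \<and> z / x \<in> K}"
    then show "z \<in> (\<lambda>\<kappa>. \<kappa> * x) ` (K - {0})"
      using assms by (intro image_eqI[of _ _ "z / x"]) auto
  qed (use assms in auto)
  then show ?thesis
    using card_K_mult[OF assms] by simp
qed

text \<open>These are the values of \<mu> coming from scalars outside K, that is, from scalars that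
  could raise a weight.\<close>

definition M :: "'a set" where
  "M = range (\<lambda>l. \<sigma>' l - l) - {0}"

text \<open>The map \<open>\<sigma>' l - l\<close> is additive with kernel K, so its fibres are
  cosets of K.\<close>

lemma card_M: "card M = q ^ (n - 1) - 1"
proof -
  let ?f = "\<lambda>l. \<sigma>' l - l"
  have "card {z \<in> UNIV. ?f z = ?f x} = q" for x
  proof -
    have "{z \<in> UNIV. ?f z = ?f x} = (\<lambda>\<kappa>. x + \<kappa>) ` K"
    proof (intro equalityI subsetI)
      fix z assume "z \<in> {z \<in> UNIV. ?f z = ?f x}"
      then have "\<sigma>' (z - x) = z - x"
        by (simp add: S'.diff algebra_simps)
      then have "z - x \<in> K"
        by (simp add: \<sigma>_fixed_iff)
      then show "z \<in> (\<lambda>\<kappa>. x + \<kappa>) ` K"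
        by (intro image_eqI[of _ _ "z - x"]) auto
    qed (auto simp: S'.add)
    then show ?thesis
      by (simp add: card_image card_range inj_on_def)
  qed
  then have "q ^ n = q * card (range ?f)"
    using card_by_fibers[of UNIV ?f q] card_a by simp
  also have "q ^ n = q * q ^ (n - 1)"
    using n_gt_0 by (simp flip: power_Suc)
  finally have "card (range ?f) = q ^ (n - 1)"
    using q_gt_1 by simp
  moreover have "0 \<in> range ?f"
    by (rule range_eqI[of _ _ 0]) simp
  ultimately show ?thesis
    by (simp add: M_def)
qed

lemma M_iff: "\<mu> \<in> M \<longleftrightarrow> (\<exists>l. l \<notin> K \<and> \<mu> = \<sigma>' l - l)"
proof -
  have "\<mu> \<in> M \<longleftrightarrow> (\<exists>l. \<mu> = \<sigma>' l - l \<and> \<sigma>' l - l \<noteq> 0)"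
    by (auto simp: M_def)
  also have "\<dots> \<longleftrightarrow> (\<exists>l. l \<notin> K \<and> \<mu> = \<sigma>' l - l)"
    by (simp only: right_minus_eq \<sigma>_fixed_iff conj_commute)
  finally show ?thesis .
qed

lemma K_mult_M: "\<kappa> \<in> K \<Longrightarrow> \<kappa> \<noteq> 0 \<Longrightarrow> \<mu> \<in> M \<Longrightarrow> \<kappa> * \<mu> \<in> M"
proof -
  assume *: "\<kappa> \<in> K" "\<kappa> \<noteq> 0" "\<mu> \<in> M"
  then obtain l where l: "\<mu> = \<sigma>' l - l"
    by (auto simp: M_def)
  have "\<kappa> * \<mu> = \<sigma>' (\<kappa> * l) - \<kappa> * l"
    using * by (auto simp: l S'.mult algebra_simps)
  with * show "\<kappa> * \<mu> \<in> M"
    by (auto simp: M_def)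
qed

definition nontriv :: "'a set" where
  "nontriv = {x. x \<noteq> 0 \<and> stab x \<noteq> K}"

text \<open>The incidence relation between elements x with a larger stabiliser and the \<mu>
  witnessing it; it is counted along both coordinates.\<close>

definition Z :: "('a \<times> 'a) set" where
  "Z = {(x, \<mu>). x \<noteq> 0 \<and> \<mu> \<in> M \<and> \<sigma> \<mu> * \<sigma> x = - a * \<mu> * \<sigma>' x}"

lemma Z_iff: "(x, \<mu>) \<in> Z \<longleftrightarrow> x \<noteq> 0 \<and> (\<exists>l. l \<notin> K \<and> l \<in> stab x \<and> \<mu> = \<sigma>' l - l)"
  by (auto simp: Z_def M_iff stab_iff)

lemma nontriv_eq: "nontriv = fst ` Z"
proof -
  have "stab x \<noteq> K \<longleftrightarrow> (\<exists>l. l \<notin> K \<and> l \<in> stab x)" for x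
    using range_subset_stab[of x] by blast
  then have "x \<in> nontriv \<longleftrightarrow> (\<exists>\<mu>. (x, \<mu>) \<in> Z)" for x
    unfolding nontriv_def Z_iff by simp
  then show ?thesis
    by (simp add: set_eq_iff image_iff) (metis fst_conv prod.collapse)
qed

text \<open>Dividing the two equations cancels x and a and shows that \<sigma> fixes the
  quotient.\<close>

lemma Z_\<mu>_ratio:
  assumes "(x, \<mu>) \<in> Z" "(x, \<mu>') \<in> Z"
  shows "\<mu>' / \<mu> \<in> K"
proof -
  have nz: "x \<noteq> 0" "\<mu> \<noteq> 0" "\<mu>' \<noteq> 0"
    using assms by (auto simp: Z_def M_def)
  have "\<sigma> \<mu> * \<sigma> x = - a * \<mu> * \<sigma>' x" "\<sigma> \<mu>' * \<sigma> x = - a * \<mu>' * \<sigma>' x"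
    using assms by (simp_all only: Z_def mem_Collect_eq case_prod_conv)
  then have "(\<sigma> \<mu>' * \<mu>) * (\<sigma> x * \<sigma>' x) = (\<sigma> \<mu> * \<mu>') * (\<sigma> x * \<sigma>' x)"
    by algebra
  then have "\<sigma> (\<mu>' / \<mu>) = \<mu>' / \<mu>"
    using nz by (simp add: S.divide field_simps)
  then show ?thesis
    by (simp add: \<sigma>_fixed_iff)
qed

lemma Z_scale:
  assumes "(x, \<mu>) \<in> Z" "\<kappa> \<in> K" "\<kappa> \<noteq> 0"
  shows "(x, \<kappa> * \<mu>) \<in> Z" "(\<kappa> * x, \<mu>) \<in> Z"
  using assms K_mult_M by (auto simp: Z_def S.mult S'.mult mult_ac)

text \<open>Dividing the two equations cancels \<mu> and a, so \<sigma> and its inverse agree on x /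
  y.\<close>

lemma Z_x_ratio:
  assumes "(x, \<mu>) \<in> Z" "(y, \<mu>) \<in> Z"
  shows "x / y \<in> K"
proof -
  have nz: "x \<noteq> 0" "y \<noteq> 0" "\<mu> \<noteq> 0"
    using assms by (auto simp: Z_def M_def)
  have "\<sigma> \<mu> * \<sigma> x = - a * \<mu> * \<sigma>' x" "\<sigma> \<mu> * \<sigma> y = - a * \<mu> * \<sigma>' y"
    using assms by (simp_all only: Z_def mem_Collect_eq case_prod_conv)
  then have "(\<sigma> x * \<sigma>' y) * (\<sigma> \<mu> * (a * \<mu>)) = (\<sigma> y * \<sigma>' x) * (\<sigma> \<mu> * (a * \<mu>))"
    by algebra
  then have "\<sigma> (x / y) = \<sigma>' (x / y)"
    using nz a_nz by (simp add: S.divide S'.divide field_simps)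
  then show ?thesis
    by (simp add: K_iff_\<sigma>_eq_\<sigma>')
qed

lemma card_Z_fst: "card Z = (q - 1) * card nontriv"
  unfolding nontriv_eq
proof (rule card_by_fibers)
  fix p assume p: "p \<in> Z"
  obtain x \<mu> where px: "p = (x, \<mu>)" by (cases p)
  have "{z \<in> Z. fst z = fst p} = Pair x ` (\<lambda>\<kappa>. \<kappa> * \<mu>) ` (K - {0})"
  proof (intro equalityI subsetI)
    fix z assume "z \<in> {z \<in> Z. fst z = fst p}"
    then obtain \<mu>' where z: "z = (x, \<mu>')" "(x, \<mu>') \<in> Z"
      by (cases z) (auto simp: px)
    moreover have "\<mu>' / \<mu> \<in> K" "\<mu> \<noteq> 0" "\<mu>' \<noteq> 0"
      using Z_\<mu>_ratio[of x \<mu> \<mu>'] z p px by (auto simp: Z_def M_def)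
    ultimately show "z \<in> Pair x ` (\<lambda>\<kappa>. \<kappa> * \<mu>) ` (K - {0})"
      unfolding z(1) by (intro imageI image_eqI[of _ _ "\<mu>' / \<mu>"]) auto
  qed (use p px Z_scale in auto)
  moreover have "\<mu> \<noteq> 0"
    using p px by (auto simp: Z_def M_def)
  ultimately show "card {z \<in> Z. fst z = fst p} = q - 1"
    using card_K_mult[of \<mu>] by (simp add: card_image inj_on_def)
qed simp

text \<open>Every \<mu> in \<open>M\<close> occurs, by Hilbert 90 for the square of \<sigma>; by
  \<open>Z_x_ratio\<close> the fibre over \<mu> is one class modulo the nonzero elements of
  K.\<close>

lemma card_Z_snd:
  assumes "frob.norm a = -1"
  shows "card Z = (q - 1) * card M"
proof -
  have "snd ` Z = M"
  proof (intro equalityI subsetI)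
    fix \<mu> assume \<mu>: "\<mu> \<in> M"
    then have "\<mu> \<noteq> 0"
      by (auto simp: M_def)
    interpret R: cyclic_aut "frobenius ^^ (2 * m)" n
      using coprime_m n_odd by (intro frobenius_pow_cyclic) simp
    \<comment> \<open>With x = \<sigma>(z) the equation defining \<open>Z\<close> becomes
      \<open>?c\<close> times the square of \<sigma> at z equals z, and N(a) = -1 gives
      \<open>?c\<close> norm 1.\<close>
    let ?c = "\<sigma> \<mu> / (- a * \<mu>)"
    have "frob.norm ?c = 1"
      using assms \<open>\<mu> \<noteq> 0\<close>
      by (simp only: frob.norm_divide frob.norm_mult frob.norm_minus[OF n_odd] norm_\<sigma>) simp
    then have "R.norm ?c = 1"
      using coprime_m n_odd by (subst frobenius_pow_cyclic) simp_all
    then obtain z where z: "z \<noteq> 0" "?c * (frobenius ^^ (2 * m)) z = z"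
      by (rule R.hilbert90)
    moreover have "- a * \<mu> \<noteq> 0"
      using a_nz \<open>\<mu> \<noteq> 0\<close> by simp
    ultimately have "\<sigma> \<mu> * (frobenius ^^ (2 * m)) z = - a * \<mu> * z"
      by (metis nonzero_eq_divide_eq times_divide_eq_left mult.commute)
    then have "\<sigma> \<mu> * \<sigma> (\<sigma> z) = - a * \<mu> * z"
      by (simp add: mult_2 funpow_add)
    then have "(\<sigma> z, \<mu>) \<in> Z"
      using z \<mu> by (simp add: Z_def)
    then show "\<mu> \<in> snd ` Z"
      by force
  qed (auto simp: Z_def)
  moreover have "card Z = (q - 1) * card (snd ` Z)"
  proof (rule card_by_fibers)
    fix p assume p: "p \<in> Z"
    obtain x \<mu> where px: "p = (x, \<mu>)" by (cases p)
    have "{z \<in> Z. snd z = snd p} = (\<lambda>x. (x, \<mu>)) ` (\<lambda>\<kappa>. \<kappa> * x) ` (K - {0})"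
    proof (intro equalityI subsetI)
      fix z assume "z \<in> {z \<in> Z. snd z = snd p}"
      then obtain y where z: "z = (y, \<mu>)" "(y, \<mu>) \<in> Z"
        by (cases z) (auto simp: px)
      moreover have "y / x \<in> K" "x \<noteq> 0" "y \<noteq> 0"
        using Z_x_ratio[of y \<mu> x] z p px by (auto simp: Z_def)
      ultimately show "z \<in> (\<lambda>x. (x, \<mu>)) ` (\<lambda>\<kappa>. \<kappa> * x) ` (K - {0})"
        unfolding z(1) by (intro imageI image_eqI[of _ _ "y / x"]) auto
    qed (use p px Z_scale in auto)
    moreover have "x \<noteq> 0"
      using p px by (auto simp: Z_def)
    ultimately show "card {z \<in> Z. snd z = snd p} = q - 1"
      using card_K_mult[of x] by (simp add: card_image inj_on_def)
  qed simp
  ultimately show ?thesis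
    by simp
qed

lemma card_nontriv:
  assumes "frob.norm a = -1"
  shows "card nontriv = q ^ (n - 1) - 1"
  using card_Z_fst card_Z_snd[OF assms] card_M q_gt_1 by simp

text \<open>With l a stabilising scalar outside K, the set is K + K l. For any other l' the quotient
  of the two values of \<mu> lies in K, and subtracting that multiple of l leaves an element of
  K.\<close>

lemma card_stab:
  assumes "x \<in> nontriv"
  shows "card (stab x) = q ^ 2"
proof -
  obtain \<mu> where Z: "(x, \<mu>) \<in> Z"
    using assms by (auto simp: nontriv_eq)
  then obtain l where l: "l \<notin> K" "l \<in> stab x" "\<mu> = \<sigma>' l - l"
    by (auto simp: Z_iff)
  have "\<mu> \<noteq> 0" "x \<noteq> 0"
    using Z by (auto simp: Z_def M_def)
  let ?f = "\<lambda>(\<kappa>, \<kappa>'). \<kappa> + \<kappa>' * l"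
  have "stab x = ?f ` (K \<times> K)"
  proof (intro equalityI subsetI)
    fix l' assume l': "l' \<in> stab x"
    define \<kappa>' where "\<kappa>' = (\<sigma>' l' - l') / \<mu>"
    have "\<kappa>' \<in> K"
    proof (cases "l' \<in> K")
      case True
      then show ?thesis
        using range_\<iota>_closed(1) by (auto simp: \<kappa>'_def)
    next
      case False
      then have "(x, \<sigma>' l' - l') \<in> Z"
        using l' \<open>x \<noteq> 0\<close> by (auto simp: Z_iff)
      then show ?thesis
        unfolding \<kappa>'_def using Z_\<mu>_ratio[OF Z] by simp
    qed
    then have fixed: "\<sigma>' \<kappa>' = \<kappa>'"
      by (simp add: \<sigma>_fixed_iff)
    have "\<kappa>' * (\<sigma>' l - l) = \<sigma>' l' - l'"
      using \<open>\<mu> \<noteq> 0\<close> by (simp add: \<kappa>'_def flip: l(3))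
    then have "\<sigma>' (l' - \<kappa>' * l) = l' - \<kappa>' * l"
      by (simp add: S'.hom fixed algebra_simps)
    then have "l' - \<kappa>' * l \<in> K"
      by (simp add: \<sigma>_fixed_iff)
    with \<open>\<kappa>' \<in> K\<close> show "l' \<in> ?f ` (K \<times> K)"
      by (intro image_eqI[of _ _ "(l' - \<kappa>' * l, \<kappa>')"]) auto
  next
    fix l' assume "l' \<in> ?f ` (K \<times> K)"
    then obtain c c' where "l' = \<iota> c + \<iota> c' * l"
      by auto
    moreover have "A (l * x) = l * A x"
      using l(2) by (simp add: stab_def)
    ultimately show "l' \<in> stab x"
      by (simp add: stab_def distrib_right A_add A_emb mult.assoc)
  qed
  moreover have "inj_on ?f (K \<times> K)"
  proof (rule inj_onI, clarify)
    fix c1 c1' c2 c2' assume eq: "\<iota> c1 + \<iota> c1' * l = \<iota> c2 + \<iota> c2' * l"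
    have "\<iota> c1' = \<iota> c2'"
    proof (rule ccontr)
      assume "\<iota> c1' \<noteq> \<iota> c2'"
      then have "l = (\<iota> c2 - \<iota> c1) / (\<iota> c1' - \<iota> c2')"
        using eq by (simp add: field_simps)
      also have "\<dots> \<in> K"
        by (intro range_\<iota>_closed K_diff) auto
      finally show False
        using l(1) by simp
    qed
    then show "\<iota> c1 = \<iota> c2 \<and> \<iota> c1' = \<iota> c2'"
      using eq by simp
  qed
  ultimately show ?thesis
    by (simp add: card_image card_cartesian_product card_range power2_eq_square)
qed

lemma stab_K_mult:
  assumes "\<kappa> \<in> K" "\<kappa> \<noteq> 0"
  shows "stab (\<kappa> * x) = stab x"
proof -
  obtain c where c: "\<kappa> = \<iota> c"
    using assms by auto
  have "A (l * (\<iota> c * x)) = \<iota> c * A (l * x)" for l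
    by (simp only: mult.left_commute[of l] A_emb)
  then show ?thesis
    using assms(2) by (simp add: stab_def c A_emb mult.left_commute)
qed

text \<open>The pair is K-dependent with a nonzero entry in \<open>nontriv\<close>. Splitting by
  whether y vanishes makes the two cases disjoint and easy to count.\<close>

definition heavy :: "'a \<Rightarrow> 'a \<Rightarrow> bool" where
  "heavy x y \<longleftrightarrow> y \<in> nontriv \<and> (\<exists>\<kappa>\<in>K. x = \<kappa> * y) \<or> x \<in> nontriv \<and> y = 0"

text \<open>A common scalar outside K gives x and y the same \<mu>, so \<open>Z_x_ratio\<close>
  makes them proportional over K when both are nonzero.\<close>

lemma stab_Int_cases:
  assumes "x \<noteq> 0 \<or> y \<noteq> 0"
  shows "stab x \<inter> stab y = K \<and> \<not> heavy x y \<or> card (stab x \<inter> stab y) = q ^ 2 \<and> heavy x y"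
proof (cases "heavy x y")
  case True
  then have "stab x \<inter> stab y = stab y \<and> y \<in> nontriv \<or> stab x \<inter> stab y = stab x \<and> x \<in> nontriv"
    unfolding heavy_def using stab_K_mult by (cases "x = 0") auto
  then show ?thesis
    using True card_stab by auto
next
  case False
  have "l \<in> K" if l: "l \<in> stab x" "l \<in> stab y" for l
  proof (rule ccontr)
    assume "l \<notin> K"
    let ?\<mu> = "\<sigma>' l - l"
    show False
    proof (cases "x = 0 \<or> y = 0")
      case True
      then have "x \<in> nontriv \<and> y = 0 \<or> y \<in> nontriv \<and> x = 0 * y"
        using \<open>l \<notin> K\<close> l assms by (auto simp: nontriv_def)
      with False range_\<iota>_closed(1) show False
        unfolding heavy_def by blast
    next
      case nz: False
      then have Z: "(x, ?\<mu>) \<in> Z" "(y, ?\<mu>) \<in> Z"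
        using l \<open>l \<notin> K\<close> by (auto simp: Z_iff)
      then have "x / y \<in> K" "y \<in> nontriv"
        using Z_x_ratio by (force simp: nontriv_eq)+
      moreover have "x = x / y * y"
        using nz by simp
      ultimately show False
        using False unfolding heavy_def by blast
    qed
  qed
  then have "stab x \<inter> stab y = K"
    using range_subset_stab[of x] range_subset_stab[of y] by (intro subset_antisym subsetI) auto
  with False show ?thesis
    by simp
qed

text \<open>Nonzero vectors are counted instead of points. A point of weight w carries q^w - 1 of
  them, and there are (q + 1)(q^(n-1) - 1) vectors on points of weight 2.\<close>

lemma points_norm_minus_1:
  assumes norm: "frob.norm a = -1"
  shows "\<forall>P \<in> linear_set U. weight \<iota> U P > 1 \<longrightarrow> weight \<iota> U P = 2"
    and "real (card {P \<in> linear_set U. weight \<iota> U P > 1}) = (real q ^ (n - 1) - 1) / (real q - 1)"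
    and "real (card (linear_set U)) = (real q ^ (2 * n) - real q ^ n) / (real q - 1) + 1"
proof -
  let ?span = "\<lambda>u. vec.span {u}"
  have heavy_nz: "x \<noteq> 0 \<or> y \<noteq> 0" if "heavy x y" for x y
    using that by (auto simp: heavy_def nontriv_def)
  have w: "weight \<iota> U (?span (pt x y)) = (if heavy x y then 2 else 1)" if "x \<noteq> 0 \<or> y \<noteq> 0" for x y
    using stab_Int_cases[OF that] that by (auto simp: weight_span_pt card_range)
  then show w2: "\<forall>P \<in> linear_set U. weight \<iota> U P > 1 \<longrightarrow> weight \<iota> U P = 2"
    by (auto simp: linear_set_U split: if_splits)
  define A2 where "A2 = {u \<in> U - {0}. weight \<iota> U (?span u) = 2}"
  define A1 where "A1 = {u \<in> U - {0}. weight \<iota> U (?span u) \<noteq> 2}"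
  let ?B = "{P \<in> linear_set U. weight \<iota> U P > 1}" and ?G = "{P \<in> linear_set U. \<not> weight \<iota> U P > 1}"
  have A2_eq: "A2 = (\<lambda>(x, y). pt x y) ` {(x, y). heavy x y}"
  proof (intro equalityI subsetI)
    fix u assume "u \<in> A2"
    then obtain x y where xy: "u = pt x y" "x \<noteq> 0 \<or> y \<noteq> 0" "weight \<iota> U (?span (pt x y)) = 2"
      by (auto simp: A2_def U_iff)
    then have "heavy x y"
      using w[OF xy(2)] by (simp split: if_splits)
    then show "u \<in> (\<lambda>(x, y). pt x y) ` {(x, y). heavy x y}"
      using xy(1) by blast
  next
    fix u assume "u \<in> (\<lambda>(x, y). pt x y) ` {(x, y). heavy x y}"
    then obtain x y where xy: "u = pt x y" "heavy x y"
      by auto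
    then show "u \<in> A2"
      using heavy_nz[OF xy(2)] w[OF heavy_nz[OF xy(2)]] by (simp add: A2_def)
  qed
  have fib: "card {z \<in> U - {0}. weight \<iota> U (?span z) \<in> D \<and> ?span z = ?span u} = q ^ weight \<iota> U (?span u) - 1"
    if u: "u \<in> U" "u \<noteq> 0" "weight \<iota> U (?span u) \<in> D" for u D
  proof -
    have "{z \<in> U - {0}. weight \<iota> U (?span z) \<in> D \<and> ?span z = ?span u} = ?span u \<inter> U - {0}"
    proof (intro set_eqI)
      fix z
      show "z \<in> {z \<in> U - {0}. weight \<iota> U (?span z) \<in> D \<and> ?span z = ?span u} \<longleftrightarrow>
          z \<in> ?span u \<inter> U - {0}"
      proof (cases "z = 0")
        case False
        then have "?span z = ?span u \<longleftrightarrow> z \<in> ?span u"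
          by (rule span_singleton_eq_iff)
        with u(3) show ?thesis
          by (cases "z \<in> ?span u") simp_all
      qed simp
    qed
    moreover have "0 \<in> ?span u \<inter> U"
      by (simp add: vec.span_zero sub.subspace_0[OF subspace_U])
    moreover have "card (?span u \<inter> U) = q ^ weight \<iota> U (?span u)"
      using weight_eq_iff[OF subspace_U vec.subspace_span] by blast
    ultimately show ?thesis
      by simp
  qed
  have "card A2 = (q ^ 2 - 1) * card (?span ` A2)"
  proof (rule card_by_fibers)
    fix u assume "u \<in> A2"
    then show "card {z \<in> A2. ?span z = ?span u} = q ^ 2 - 1"
      using fib[of u "{2}"] by (simp add: A2_def conj_ac)
  qed simp
  moreover have "?span ` A2 = ?B"
    using w2 by (auto simp: A2_def linear_set_def)
  ultimately have A2_B: "card A2 = (q ^ 2 - 1) * card ?B"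
    by simp
  have "card A1 = (q ^ 1 - 1) * card (?span ` A1)"
  proof (rule card_by_fibers)
    fix u assume u: "u \<in> A1"
    then obtain x y where xy: "u = pt x y" "x \<noteq> 0 \<or> y \<noteq> 0"
      by (auto simp: A1_def U_iff)
    then have "weight \<iota> U (?span u) = 1"
      using u w[OF xy(2)] by (auto simp: A1_def split: if_splits)
    then show "card {z \<in> A1. ?span z = ?span u} = q ^ 1 - 1"
      using u fib[of u "- {2}"] by (simp add: A1_def conj_ac)
  qed simp
  moreover have "?span ` A1 = ?G"
    using w2 by (auto simp: A1_def linear_set_def)
  ultimately have A1_G: "card A1 = (q - 1) * card ?G"
    by simp
  have "card A2 = card {(x, y). heavy x y}"
    unfolding A2_eq by (rule card_image) (auto simp: inj_on_def)
  also have "{(x, y). heavy x y} = (\<lambda>(\<kappa>, y). (\<kappa> * y, y)) ` (K \<times> nontriv) \<union> (\<lambda>x. (x, 0)) ` nontriv"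
    by (auto simp: heavy_def image_iff)
  also have "card \<dots> = card ((\<lambda>(\<kappa>, y). (\<kappa> * y, y)) ` (K \<times> nontriv)) + card ((\<lambda>x. (x, 0 :: 'a)) ` nontriv)"
    by (rule card_Un_disjoint) (auto simp: nontriv_def)
  also have "card ((\<lambda>(\<kappa>, y). (\<kappa> * y, y)) ` (K \<times> nontriv)) = card (K \<times> nontriv)"
    by (rule card_image) (auto simp: inj_on_def nontriv_def)
  also have "card ((\<lambda>x. (x, 0 :: 'a)) ` nontriv) = card nontriv"
    by (rule card_image) (auto simp: inj_on_def)
  finally have A2: "card A2 = (q + 1) * (q ^ (n - 1) - 1)"
    by (simp add: card_cartesian_product card_range card_nontriv[OF norm])
  have "0 \<in> U"
    using subspace_U by (simp add: sub.subspace_def)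
  then have "card (U - {0}) = q ^ (2 * n) - 1"
    by (simp add: card_U)
  moreover have "U - {0} = A1 \<union> A2"
    by (auto simp: A1_def A2_def)
  moreover have "card (A1 \<union> A2) = card A1 + card A2"
    by (rule card_Un_disjoint) (auto simp: A1_def A2_def)
  ultimately have A12: "card A1 + card A2 = q ^ (2 * n) - 1"
    by simp
  have "card (linear_set U) = card (?B \<union> ?G)"
    by (rule arg_cong[of _ _ card]) auto
  also have "\<dots> = card ?B + card ?G"
    by (rule card_Un_disjoint) auto
  finally have L: "card (linear_set U) = card ?B + card ?G" .
  \<comment> \<open>The arithmetic moves to the reals to avoid truncated subtraction; the factor q +
    1 will cancel.\<close>
  define Q where "Q = real q ^ (n - 1)"
  have q1: "real q - 1 > 0" "1 \<le> q"
    using q_gt_1 by auto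
  have "real (q ^ i - 1) = real q ^ i - 1" for i
    using q1 by (simp add: of_nat_diff)
  note real_pow = this
  have "(q ^ 2 - 1) * card ?B = (q + 1) * (q ^ (n - 1) - 1)"
    using A2_B A2 by (rule trans[OF sym])
  from arg_cong[OF this, of real]
  have "(real q ^ 2 - 1) * real (card ?B) = (real q + 1) * (Q - 1)"
    by (simp only: of_nat_mult of_nat_add real_pow of_nat_1 Q_def)
  then have "(real q + 1) * ((real q - 1) * real (card ?B)) = (real q + 1) * (Q - 1)"
    by (simp add: power2_eq_square algebra_simps)
  then have B: "(real q - 1) * real (card ?B) = Q - 1"
    by simp
  then show "real (card ?B) = (real q ^ (n - 1) - 1) / (real q - 1)"
    using q1 by (simp add: Q_def field_simps)
  have "real (card A1) + real (card A2) = real q ^ (2 * n) - 1"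
    using arg_cong[OF A12, of real] by (simp only: real_pow of_nat_add)
  moreover have "real (card A2) = (real q + 1) * (Q - 1)"
    unfolding A2 by (simp only: of_nat_mult real_pow Q_def) simp
  moreover have "real (card A1) = (real q - 1) * real (card ?G)"
    unfolding A1_G using real_pow[of 1] by simp
  moreover have "real q * Q = real q ^ n"
    unfolding Q_def using n_gt_0 by (simp flip: power_Suc)
  ultimately have "(real q - 1) * (real (card ?B) + real (card ?G)) = real q ^ (2 * n) - real q ^ n + (real q - 1)"
    using B by (simp add: algebra_simps)
  then show "real (card (linear_set U)) = (real q ^ (2 * n) - real q ^ n) / (real q - 1) + 1"
    unfolding L using q1 by (simp add: field_simps)
qed

end

subsection \<open>Long lines not of pseudoregulus type\<close>

lemma sum_by_fibers:
  fixes F :: "'b \<Rightarrow> 'c::comm_semiring_1"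
  assumes "finite A" and "\<And>x. x \<in> A \<Longrightarrow> card {z \<in> A. f z = f x} = c"
  shows "(\<Sum>x\<in>A. F (f x)) = of_nat c * (\<Sum>y\<in>f ` A. F y)"
proof -
  have "(\<Sum>x\<in>A. F (f x)) = (\<Sum>y\<in>f ` A. \<Sum>x | x \<in> A \<and> f x = y. F (f x))"
    by (rule sum.image_gen[OF assms(1)])
  also have "\<dots> = (\<Sum>y\<in>f ` A. of_nat c * F y)"
    using assms(2) by (intro sum.cong) auto
  finally show ?thesis
    by (simp add: sum_distrib_left)
qed

lemma independent_pairD:
  fixes w v :: "'a::field ^ 4"
  assumes "vec.independent {w, v}" "w \<noteq> v" "\<alpha> *s w + \<beta> *s v = 0"
  shows "\<alpha> = 0 \<and> \<beta> = 0"
proof -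
  let ?u = "\<lambda>z. if z = w then \<alpha> else \<beta>"
  have "(\<Sum>z\<in>{w, v}. ?u z *s z) = 0"
    using assms(2,3) by simp
  then have "?u z = 0" if "z \<in> {w, v}" for z
    using vec.independentD[OF assms(1), of "{w, v}" ?u z] that by simp
  from this[of w] this[of v] assms(2) show ?thesis
    by auto
qed

context D_A_set
begin

text \<open>Both quotient maps are (q - 1)-to-one on nonzero elements, so equal value sets give
  equal sums for every \<open>F\<close>. As \<sigma> is a power of \<tau>, the left quotient is a
  binomial in \<tau>, and \<open>binomial_sum_not_fraction_sum\<close> applies.\<close>

lemma ratio_set_not_pseudoregulus:
  assumes n: "n > 3" and norm: "frob.norm a \<noteq> -1" and "\<zeta> \<noteq> 0"
    and \<tau>: "field_automorphism \<tau>" "{x. \<tau> x = x} = K"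
    and det: "w1 * v2 - w2 * v1 \<noteq> 0"
    and nz: "\<And>c. c \<noteq> 0 \<Longrightarrow> w1 * c + v1 * \<tau> c \<noteq> 0"
    and eq: "(\<lambda>x. \<zeta> * A x / x) ` (-{0}) = (\<lambda>c. (w2 * c + v2 * \<tau> c) / (w1 * c + v1 * \<tau> c)) ` (-{0})"
  shows False
proof -
  let ?f = "\<lambda>x. \<zeta> * A x / x" and ?g = "\<lambda>c. (w2 * c + v2 * \<tau> c) / (w1 * c + v1 * \<tau> c)"
  have \<tau>_fixed: "\<tau> x = x \<longleftrightarrow> x \<in> K" for x
    using \<tau>(2) by blast
  interpret T: cyclic_aut \<tau> n
    by (rule frob.cyclic_aut_same_fixed)
      (simp_all add: field_aut_def \<tau>(1) \<tau>_fixed frobenius_fixed_iff)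
  obtain j where j: "j < n" "\<sigma> = \<tau> ^^ j"
    using T.aut_is_pow[OF S.field_aut_axioms] \<tau>_fixed \<sigma>_fixed_iff by blast
  have j0: "0 < j"
  proof (rule ccontr)
    assume "\<not> 0 < j"
    then have "x \<in> K" for x
      using j \<sigma>_fixed_iff(1)[of x] by simp
    then have "K = UNIV"
      by blast
    then have "q ^ n = q ^ 1"
      using card_range card_a by simp
    then show False
      using q_gt_1 n by (subst (asm) power_inject_exp) auto
  qed
  have \<sigma>': "\<sigma>' x = (\<tau> ^^ (n - j)) x" for x
  proof -
    have "\<sigma> ((\<tau> ^^ (n - j)) x) = (\<tau> ^^ (j + (n - j))) x"
      by (simp only: j(2) funpow_add comp_apply)
    also have "\<dots> = x"
      using j(1) T.period by simp
    finally show ?thesis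
      by (metis \<sigma>_inv(2))
  qed
  have f: "?f x = (\<zeta> * (\<tau> ^^ j) x + - \<zeta> * a * (\<tau> ^^ (n - j)) x) / x" for x
    by (simp add: A_eq \<sigma>' j(2) algebra_simps)
  \<comment> \<open>Equal values at z and x mean that z / x lies in \<open>stab x\<close>, which is
    K because N(a) is not -1.\<close>
  have f_fibers: "card {z \<in> -{0}. ?f z = ?f x} = q - 1" if "x \<in> -{0}" for x
  proof -
    from that have x: "x \<noteq> 0" by simp
    have "?f z = ?f x \<longleftrightarrow> z / x \<in> K" if "z \<noteq> 0" for z
    proof -
      have "?f z = ?f x \<longleftrightarrow> A (z / x * x) = z / x * A x"
        using x that \<open>\<zeta> \<noteq> 0\<close> by (simp add: field_simps)
      also have "\<dots> \<longleftrightarrow> z / x \<in> stab x"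
        by (simp add: stab_def)
      finally show ?thesis
        by (simp add: stab_trivial[OF norm x])
    qed
    then have "{z \<in> -{0}. ?f z = ?f x} = {z. z \<noteq> 0 \<and> z / x \<in> K}"
      by blast
    then show ?thesis
      by (simp only: card_K_class[OF x])
  qed
  have g_fibers: "card {z \<in> -{0}. ?g z = ?g x} = q - 1" if "x \<in> -{0}" for x
  proof -
    from that have x: "x \<noteq> 0" by simp
    have "?g z = ?g x \<longleftrightarrow> z / x \<in> K" if "z \<noteq> 0" for z
    proof -
      have "?g z = ?g x \<longleftrightarrow> (w2 * z + v2 * \<tau> z) * (w1 * x + v1 * \<tau> x) = (w2 * x + v2 * \<tau> x) * (w1 * z + v1 * \<tau> z)"
        using nz[OF x] nz[OF that] by (simp add: frac_eq_eq)
      \<comment> \<open>The cross-multiplied difference factors through the determinant.\<close>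
      also have "\<dots> \<longleftrightarrow> (w1 * v2 - w2 * v1) * (\<tau> z * x - z * \<tau> x) = 0"
        by algebra
      also have "\<dots> \<longleftrightarrow> \<tau> z * x = z * \<tau> x"
        using det by simp
      also have "\<dots> \<longleftrightarrow> \<tau> (z / x) = z / x"
        using x by (simp add: T.divide frac_eq_eq)
      finally show ?thesis
        by (simp add: \<tau>_fixed)
    qed
    then have "{z \<in> -{0}. ?g z = ?g x} = {z. z \<noteq> 0 \<and> z / x \<in> K}"
      by blast
    then show ?thesis
      by (simp only: card_K_class[OF x])
  qed
  show False
  proof (rule T.binomial_sum_not_fraction_sum[of j \<zeta> "- \<zeta> * a" w1 v2 w2 v1])
    fix F :: "'a \<Rightarrow> 'a"
    have "(\<Sum>x\<in>-{0}. F (?f x)) = (\<Sum>c\<in>-{0}. F (?g c))"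
      using sum_by_fibers[of "-{0}" ?f "q - 1" F] sum_by_fibers[of "-{0}" ?g "q - 1" F]
        f_fibers g_fibers eq by simp
    then show "(\<Sum>x\<in>- {0}. F ((\<zeta> * (\<tau> ^^ j) x + - \<zeta> * a * (\<tau> ^^ (n - j)) x) / x)) =
        (\<Sum>c\<in>- {0}. F ((w2 * c + v2 * \<tau> c) / (w1 * c + v1 * \<tau> c)))"
      by (simp only: f)
    show "j \<noteq> n - j"
      using n_odd j(1) by presburger
  qed (use n j j0 two_neq_0 \<open>\<zeta> \<noteq> 0\<close> a_nz det nz in auto)
qed

text \<open>Coordinates i and j identify W with a plane. The quotient of the two coordinates is an
  affine parameter of a point, so equality of point sets becomes equality of value sets.\<close>

lemma not_pseudoregulus_type_on:
  assumes n: "n > 3" and norm: "frob.norm a \<noteq> -1" and "\<zeta> \<noteq> 0"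
    and pts: "points_on L W = {vec.span {e x} |x. x \<noteq> 0}"
    and e: "\<And>x. e x $ i = x" "\<And>x. e x $ j = \<zeta> * A x"
    and W: "vec.subspace W" "\<And>u. u \<in> W \<Longrightarrow> u $ i = 0 \<Longrightarrow> u $ j = 0 \<Longrightarrow> u = 0"
  shows "\<not> pseudoregulus_type_on \<iota> W (points_on L W)"
proof
  assume "pseudoregulus_type_on \<iota> W (points_on L W)"
  then obtain w v \<rho> \<tau> where wv: "w \<in> W" "v \<in> W" "w \<noteq> v" "vec.independent {w, v}" "\<rho> \<noteq> 0"
    and \<tau>: "field_automorphism \<tau>" "{x. \<tau> x = x} = K"
    and pts': "points_on L W = {vec.span {c *s w + (\<rho> * \<tau> c) *s v} |c. c \<noteq> 0}"
    unfolding pseudoregulus_type_on_def by blast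
  define p where "p c = c *s w + (\<rho> * \<tau> c) *s v" for c
  have p_nth: "p c $ l = w $ l * c + \<rho> * v $ l * \<tau> c" for c l
    by (simp add: p_def)
  \<comment> \<open>If the determinant vanished, both coordinates of
    \<open>v $ l *s w - w $ l *s v\<close> would be 0 for l = i, j; independence would then give v =
    0.\<close>
  have det0: "w $ i * v $ j - w $ j * v $ i \<noteq> 0"
  proof
    assume 0: "w $ i * v $ j - w $ j * v $ i = 0"
    have "v $ l *s w + (- w $ l) *s v = 0" if "l = i \<or> l = j" for l
    proof (rule W(2))
      show "v $ l *s w + (- w $ l) *s v \<in> W"
        by (intro vec.subspace_add vec.subspace_scale W(1) wv(1,2))
    qed (use 0 that in \<open>auto simp: algebra_simps\<close>)
    then have "v $ l = 0" if "l = i \<or> l = j" for l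
      using independent_pairD[OF wv(4,3)] that by blast
    then have "v = 0"
      using W(2)[OF wv(2)] by blast
    then show False
      using wv(4) vec.dependent_zero by blast
  qed
  have key: "p c $ i \<noteq> 0 \<and> p c $ j / p c $ i = \<zeta> * A x / x"
    if "vec.span {e x} = vec.span {p c}" "x \<noteq> 0" for c x
  proof -
    have "e x \<in> vec.span {p c}"
      using that(1) vec.span_base[of "e x" "{e x}"] by simp
    then obtain l where l: "e x = l *s p c"
      by (auto simp: vec.span_singleton)
    have "x = l * p c $ i" "\<zeta> * A x = l * p c $ j"
      using e[of x] by (simp_all add: l)
    then show ?thesis
      using that(2) by auto
  qed
  have to_x: "\<exists>x. x \<noteq> 0 \<and> vec.span {e x} = vec.span {p c}" if "c \<noteq> 0" for c
  proof -
    have "vec.span {p c} \<in> points_on L W"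
      unfolding pts' p_def using that by blast
    then show ?thesis
      unfolding pts by auto
  qed
  have to_c: "\<exists>c. c \<noteq> 0 \<and> vec.span {e x} = vec.span {p c}" if "x \<noteq> 0" for x
  proof -
    have "vec.span {e x} \<in> points_on L W"
      unfolding pts using that by blast
    then show ?thesis
      unfolding pts' p_def by auto
  qed
  show False
  proof (rule ratio_set_not_pseudoregulus[OF n norm \<open>\<zeta> \<noteq> 0\<close> \<tau>])
    have "w $ i * (\<rho> * v $ j) - w $ j * (\<rho> * v $ i) = \<rho> * (w $ i * v $ j - w $ j * v $ i)"
      by (simp add: algebra_simps)
    then show "w $ i * (\<rho> * v $ j) - w $ j * (\<rho> * v $ i) \<noteq> 0"
      using det0 wv(5) by simp
    show "w $ i * c + \<rho> * v $ i * \<tau> c \<noteq> 0" if "c \<noteq> 0" for c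
      using to_x[OF that] key by (auto simp flip: p_nth)
    show "(\<lambda>x. \<zeta> * A x / x) ` (-{0}) =
        (\<lambda>c. (w $ j * c + \<rho> * v $ j * \<tau> c) / (w $ i * c + \<rho> * v $ i * \<tau> c)) ` (-{0})"
      unfolding p_nth[symmetric]
    proof (intro equalityI subsetI)
      fix y assume "y \<in> (\<lambda>x. \<zeta> * A x / x) ` (-{0})"
      then obtain x where x: "x \<noteq> 0" "y = \<zeta> * A x / x" by auto
      then obtain c where "c \<noteq> 0" "vec.span {e x} = vec.span {p c}"
        using to_c by blast
      then show "y \<in> (\<lambda>c. p c $ j / p c $ i) ` (-{0})"
        using key[of x c] x by (intro image_eqI[of _ _ c]) auto
    next
      fix y assume "y \<in> (\<lambda>c. p c $ j / p c $ i) ` (-{0})"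
      then obtain c where c: "c \<noteq> 0" "y = p c $ j / p c $ i" by auto
      then obtain x where "x \<noteq> 0" "vec.span {e x} = vec.span {p c}"
        using to_x by blast
      then show "y \<in> (\<lambda>x. \<zeta> * A x / x) ` (-{0})"
        using key[of x c] c by (intro image_eqI[of _ _ x]) auto
    qed
  qed
qed

section \<open>The two distinguished lines\<close>

lemma line_X1_X2_eq: "line_X1_X2 = range (\<lambda>(x, y). vector [x, 0, 0, y] :: 'a ^ 4)"
proof (intro equalityI subsetI)
  fix v :: "'a ^ 4" assume "v \<in> line_X1_X2"
  then show "v \<in> range (\<lambda>(x, y). vector [x, 0, 0, y] :: 'a ^ 4)"
    by (intro image_eqI[of _ _ "(v $ 1, v $ 4)"]) (auto simp: line_X1_X2_def vec4_eq_iff)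
qed (auto simp: line_X1_X2_def)

lemma line_X0_X3_eq: "line_X0_X3 = range (\<lambda>(x, y). vector [0, x, y, 0] :: 'a ^ 4)"
proof (intro equalityI subsetI)
  fix v :: "'a ^ 4" assume "v \<in> line_X0_X3"
  then show "v \<in> range (\<lambda>(x, y). vector [0, x, y, 0] :: 'a ^ 4)"
    by (intro image_eqI[of _ _ "(v $ 2, v $ 3)"]) (auto simp: line_X0_X3_def vec4_eq_iff)
qed (auto simp: line_X0_X3_def)

lemma is_line_X1_X2: "is_line (line_X1_X2 :: ('a ^ 4) set)"
proof -
  have "card (line_X1_X2 :: ('a ^ 4) set) = CARD('a \<times> 'a)"
    unfolding line_X1_X2_eq by (rule card_image) (auto simp: inj_def vec4_eq_iff)
  then show ?thesis
    by (auto simp: is_line_iff_card power2_eq_square line_X1_X2_def vec.subspace_def)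
qed

lemma is_line_X0_X3: "is_line (line_X0_X3 :: ('a ^ 4) set)"
proof -
  have "card (line_X0_X3 :: ('a ^ 4) set) = CARD('a \<times> 'a)"
    unfolding line_X0_X3_eq by (rule card_image) (auto simp: inj_def vec4_eq_iff)
  then show ?thesis
    by (auto simp: is_line_iff_card power2_eq_square line_X0_X3_def vec.subspace_def)
qed

lemma pt_in_lines:
  "pt x y \<in> line_X1_X2 \<longleftrightarrow> y = 0" "pt x y \<in> line_X0_X3 \<longleftrightarrow> x = 0"
  by (auto simp: pt_def line_X1_X2_def line_X0_X3_def \<xi>_nz)

lemma span_subset_line_iff:
  assumes "is_line W"
  shows "vec.span {u} \<subseteq> W \<longleftrightarrow> u \<in> W"
  using assms vec.span_base[of u "{u}"] vec.span_minimal[of "{u}" W]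
  by (auto simp: is_line_def)

lemma points_on_line:
  assumes "is_line W"
  shows "points_on (linear_set U) W = {vec.span {pt x y} |x y. (x \<noteq> 0 \<or> y \<noteq> 0) \<and> pt x y \<in> W}"
  unfolding points_on_def linear_set_U span_subset_line_iff[OF assms, symmetric] by blast

lemma long_lines: "long_line \<iota> n U line_X1_X2" "long_line \<iota> n U line_X0_X3"
proof -
  have "line_X1_X2 \<inter> U = range (\<lambda>x. pt x 0)" "line_X0_X3 \<inter> U = range (\<lambda>y. pt 0 y)"
    by (auto simp: U_iff pt_in_lines)
  then have "card (line_X1_X2 \<inter> U) = q ^ n" "card (line_X0_X3 \<inter> U) = q ^ n"
    by (simp_all add: card_image inj_def card_a)
  then show "long_line \<iota> n U line_X1_X2" "long_line \<iota> n U line_X0_X3"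
    using is_line_X1_X2 is_line_X0_X3 weight_eq_iff[OF subspace_U]
    by (auto simp: long_line_def is_line_def)
qed

text \<open>On each line the points have parameter \<zeta> A(x) / x, with \<zeta> the image of \<xi>
  on the first line and \<zeta> = 1 on the second.\<close>

lemma lines_not_pseudoregulus_type:
  assumes "n > 3" "frob.norm a \<noteq> -1"
  shows "\<not> line_of_pseudoregulus_type \<iota> U line_X1_X2"
    and "\<not> line_of_pseudoregulus_type \<iota> U line_X0_X3"
proof -
  have pts: "points_on (linear_set U) line_X1_X2 = {vec.span {pt x 0} |x. x \<noteq> 0}"
    by (auto simp: points_on_line[OF is_line_X1_X2] pt_in_lines)
  have "\<not> pseudoregulus_type_on \<iota> line_X1_X2 (points_on (linear_set U) line_X1_X2)"
  proof (rule not_pseudoregulus_type_on[OF assms _ pts, where \<zeta> = "\<iota> \<xi>" and i = 1 and j = 4])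
    show "vec.subspace (line_X1_X2 :: ('a ^ 4) set)"
      using is_line_X1_X2 by (simp add: is_line_def)
  qed (auto simp: \<xi>_nz pt_def line_X1_X2_def vec4_eq_iff)
  then show "\<not> line_of_pseudoregulus_type \<iota> U line_X1_X2"
    by (simp add: line_of_pseudoregulus_type_def)
  have pts': "points_on (linear_set U) line_X0_X3 = {vec.span {pt 0 y} |y. y \<noteq> 0}"
    by (auto simp: points_on_line[OF is_line_X0_X3] pt_in_lines)
  have "\<not> pseudoregulus_type_on \<iota> line_X0_X3 (points_on (linear_set U) line_X0_X3)"
  proof (rule not_pseudoregulus_type_on[OF assms _ pts', where \<zeta> = 1 and i = 2 and j = 3])
    show "vec.subspace (line_X0_X3 :: ('a ^ 4) set)"
      using is_line_X0_X3 by (simp add: is_line_def)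
  qed (auto simp: pt_def line_X0_X3_def vec4_eq_iff)
  then show "\<not> line_of_pseudoregulus_type \<iota> U line_X0_X3"
    by (simp add: line_of_pseudoregulus_type_def)
qed

lemma lines_distinct: "line_X1_X2 \<noteq> (line_X0_X3 :: ('a ^ 4) set)"
proof
  assume "line_X1_X2 = (line_X0_X3 :: ('a ^ 4) set)"
  moreover have "pt 1 0 \<in> line_X1_X2" "pt 1 0 \<notin> line_X0_X3"
    by (simp_all add: pt_in_lines)
  ultimately show False
    by simp
qed

end

subsection \<open>Sets of pseudoregulus type\<close>

lemma meetsD:
  assumes "meets W W'" "vec.subspace W" "vec.subspace W'"
  obtains w where "w \<in> W" "w \<in> W'" "w \<noteq> 0"
proof -
  have "0 \<in> W \<inter> W'"
    using assms(2,3) by (simp add: vec.subspace_0)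
  with assms(1) show ?thesis
    using that unfolding meets_def by blast
qed

text \<open>The map \<open>E\<close> is a linear change of coordinates; the transversals are given by its first two and by
  its last two arguments.\<close>

lemma (in finite_field_ext) pseudoregulus_typeI:
  fixes E :: "'a \<Rightarrow> 'a \<Rightarrow> 'a \<Rightarrow> 'a \<Rightarrow> 'a ^ 4"
  assumes scattered: "scattered \<iota> U" and dim: "sub_dim \<iota> U = 2 * n"
    and "field_aut \<sigma>" and nontriv: "\<sigma> \<alpha>0 \<noteq> \<alpha>0"
    and E_add: "\<And>u v s t u' v' s' t'. E u v s t + E u' v' s' t' = E (u + u') (v + v') (s + s') (t + t')"
    and E_scale: "\<And>c u v s t. c *s E u v s t = E (c * u) (c * v) (c * s) (c * t)"
    and E_inj: "\<And>u v s t u' v' s' t'. E u v s t = E u' v' s' t' \<longleftrightarrow> u = u' \<and> v = v' \<and> s = s' \<and> t = t'"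
    and U: "U = {E u v (\<sigma> u) (\<sigma> v) |u v. True}"
  shows "pseudoregulus_type \<iota> n U"
proof -
  interpret S: field_aut \<sigma> by fact
  have E_0: "E 0 0 0 0 = 0"
    using E_scale[of 0 0 0 0 0] by simp
  have E_eq_0: "E u v s t = 0 \<longleftrightarrow> u = 0 \<and> v = 0 \<and> s = 0 \<and> t = 0" for u v s t
    using E_inj[of u v s t 0 0 0 0] by (simp add: E_0)
  have subspace_U: "sub.subspace U"
    using scattered by (simp add: scattered_def)
  \<comment> \<open>The line joining the point (\<alpha>, \<beta>) of one transversal to its image
    under \<sigma> on the other.\<close>
  define l where "l p = (case p of (\<alpha>, \<beta>) \<Rightarrow> {E (s * \<alpha>) (s * \<beta>) (t * \<sigma> \<alpha>) (t * \<sigma> \<beta>) |s t. True})" for p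
  \<comment> \<open>Normalised representatives of the q^n + 1 points of a projective line; \<sigma>
    preserves the normalisation.\<close>
  define D where "D = insert (1, 0) (range (\<lambda>\<alpha> :: 'a. (\<alpha>, 1 :: 'a)))"
  have D: "\<beta> = 1 \<or> \<alpha> = 1 \<and> \<beta> = 0" if "(\<alpha>, \<beta>) \<in> D" for \<alpha> \<beta>
    using that by (auto simp: D_def)
  have card_D: "card D = CARD('k) ^ n + 1"
  proof -
    have "card (range (\<lambda>\<alpha> :: 'a. (\<alpha>, 1 :: 'a))) = q ^ n"
      by (simp add: card_image inj_def card_a)
    moreover have "(1, 0) \<notin> range (\<lambda>\<alpha> :: 'a. (\<alpha>, 1 :: 'a))"
      by auto
    ultimately show ?thesis
      by (simp add: D_def card_k)
  qed
  have D_unique: "(\<alpha>, \<beta>) = (\<alpha>', \<beta>')"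
    if "(\<alpha>, \<beta>) \<in> D" "(\<alpha>', \<beta>') \<in> D" "s * \<alpha> = s' * \<alpha>'" "s * \<beta> = s' * \<beta>'" "s \<noteq> 0"
    for \<alpha> \<beta> \<alpha>' \<beta>' s s'
    using D[OF that(1)] D[OF that(2)] that(3-) by auto
  have D_\<sigma>: "(\<sigma> \<alpha>, \<sigma> \<beta>) \<in> D" if "(\<alpha>, \<beta>) \<in> D" for \<alpha> \<beta>
    using D[OF that] by (auto simp: D_def)
  have l_disjoint: "p = p'" if p: "p \<in> D" "p' \<in> D" and w: "w \<in> l p" "w \<in> l p'" "w \<noteq> 0" for p p' w
  proof -
    obtain \<alpha> \<beta> \<alpha>' \<beta>' where pp: "p = (\<alpha>, \<beta>)" "p' = (\<alpha>', \<beta>')"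
      by (cases p; cases p')
    obtain s t where st: "w = E (s * \<alpha>) (s * \<beta>) (t * \<sigma> \<alpha>) (t * \<sigma> \<beta>)"
      using w(1) by (auto simp: l_def pp)
    obtain s' t' where st': "w = E (s' * \<alpha>') (s' * \<beta>') (t' * \<sigma> \<alpha>') (t' * \<sigma> \<beta>')"
      using w(2) by (auto simp: l_def pp)
    have eqs: "s * \<alpha> = s' * \<alpha>'" "s * \<beta> = s' * \<beta>'" "t * \<sigma> \<alpha> = t' * \<sigma> \<alpha>'" "t * \<sigma> \<beta> = t' * \<sigma> \<beta>'"
      using st st' by (simp_all add: E_inj)
    have "s \<noteq> 0 \<or> t \<noteq> 0"
      using w(3) st by (auto simp: E_0)
    then show ?thesis
    proof
      assume "s \<noteq> 0"
      then show ?thesis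
        using D_unique[OF _ _ eqs(1,2)] p pp by simp
    next
      assume "t \<noteq> 0"
      then have "(\<sigma> \<alpha>, \<sigma> \<beta>) = (\<sigma> \<alpha>', \<sigma> \<beta>')"
        using D_unique[OF D_\<sigma> D_\<sigma> eqs(3,4)] p pp by simp
      then show ?thesis
        by (simp add: pp)
    qed
  qed
  have plane: "is_line {E (s * a1) (s * b1) (t * a2) (t * b2) |s t. True}"
    if "a1 \<noteq> 0 \<or> b1 \<noteq> 0" "a2 \<noteq> 0 \<or> b2 \<noteq> 0" for a1 b1 a2 b2
  proof -
    let ?W = "{E (s * a1) (s * b1) (t * a2) (t * b2) |s t. True}"
    have "?W = (\<lambda>(s, t). E (s * a1) (s * b1) (t * a2) (t * b2)) ` UNIV"
      by auto
    also have "card \<dots> = CARD('a \<times> 'a)"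
      using that by (intro card_image) (auto simp: inj_def E_inj)
    finally have "card ?W = CARD('a) ^ 2"
      by (simp add: power2_eq_square)
    moreover have "vec.subspace ?W"
    proof (rule vec.subspaceI)
      have "0 = E (0 * a1) (0 * b1) (0 * a2) (0 * b2)"
        by (simp add: E_0)
      then show "0 \<in> ?W"
        by blast
    next
      fix x y assume "x \<in> ?W" "y \<in> ?W"
      then obtain s t s' t' where "x = E (s * a1) (s * b1) (t * a2) (t * b2)"
        "y = E (s' * a1) (s' * b1) (t' * a2) (t' * b2)"
        by blast
      then have "x + y = E ((s + s') * a1) ((s + s') * b1) ((t + t') * a2) ((t + t') * b2)"
        by (simp add: E_add distrib_right)
      then show "x + y \<in> ?W"
        by blast
    next
      fix c x assume "x \<in> ?W"
      then obtain s t where "x = E (s * a1) (s * b1) (t * a2) (t * b2)"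
        by blast
      then have "c *s x = E ((c * s) * a1) ((c * s) * b1) ((c * t) * a2) ((c * t) * b2)"
        by (simp add: E_scale mult.assoc)
      then show "c *s x \<in> ?W"
        by blast
    qed
    ultimately show ?thesis
      by (simp add: is_line_iff_card)
  qed
  have line_l: "is_line (l p)" if "p \<in> D" for p
  proof -
    obtain \<alpha> \<beta> where p: "p = (\<alpha>, \<beta>)" by (cases p)
    then have "\<alpha> \<noteq> 0 \<or> \<beta> \<noteq> 0"
      using D that by force
    then show ?thesis
      unfolding l_def p prod.case by (intro plane) auto
  qed
  have long_l: "long_line \<iota> n U (l p)" if "p \<in> D" for p
  proof -
    obtain \<alpha> \<beta> where p: "p = (\<alpha>, \<beta>)" by (cases p)
    then have nz: "\<alpha> \<noteq> 0 \<or> \<beta> \<noteq> 0"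
      using D that by force
    have "l p \<inter> U = range (\<lambda>s. E (s * \<alpha>) (s * \<beta>) (\<sigma> s * \<sigma> \<alpha>) (\<sigma> s * \<sigma> \<beta>))"
    proof (intro equalityI subsetI)
      fix w assume "w \<in> l p \<inter> U"
      then obtain s t u v where "w = E (s * \<alpha>) (s * \<beta>) (t * \<sigma> \<alpha>) (t * \<sigma> \<beta>)" "w = E u v (\<sigma> u) (\<sigma> v)"
        unfolding l_def p U prod.case by blast
      \<comment> \<open>Comparing coordinates gives u = s \<alpha> and v = s \<beta>, so the last
        two entries must carry the factor \<sigma>(s).\<close>
      then have "w = E (s * \<alpha>) (s * \<beta>) (\<sigma> s * \<sigma> \<alpha>) (\<sigma> s * \<sigma> \<beta>)"
        by (simp add: E_inj S.mult)
      then show "w \<in> range (\<lambda>s. E (s * \<alpha>) (s * \<beta>) (\<sigma> s * \<sigma> \<alpha>) (\<sigma> s * \<sigma> \<beta>))"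
        by blast
    next
      fix w assume "w \<in> range (\<lambda>s. E (s * \<alpha>) (s * \<beta>) (\<sigma> s * \<sigma> \<alpha>) (\<sigma> s * \<sigma> \<beta>))"
      then obtain s where s: "w = E (s * \<alpha>) (s * \<beta>) (\<sigma> s * \<sigma> \<alpha>) (\<sigma> s * \<sigma> \<beta>)"
        by blast
      then have "w \<in> l p"
        unfolding l_def p prod.case by blast
      moreover have "w \<in> U"
        unfolding U s by (auto simp flip: S.mult)
      ultimately show "w \<in> l p \<inter> U" ..
    qed
    moreover have "inj (\<lambda>s. E (s * \<alpha>) (s * \<beta>) (\<sigma> s * \<sigma> \<alpha>) (\<sigma> s * \<sigma> \<beta>))"
      using nz by (auto simp: inj_def E_inj)
    ultimately have "card (l p \<inter> U) = q ^ n"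
      by (simp add: card_image card_a)
    then show ?thesis
      using line_l[OF that] weight_eq_iff[OF subspace_U, of "l p"]
      by (auto simp: long_line_def is_line_def)
  qed
  define T1 where "T1 = {E u v 0 0 |u v. True}"
  define T2 where "T2 = {E 0 0 u v |u v. True}"
  have line_T: "is_line T1" "is_line T2"
  proof -
    have graph: "vec.subspace {f u v |u v. True}" if
      "\<And>u v u' v'. f u v + f u' v' = f (u + u') (v + v')" "\<And>c u v. c *s f u v = f (c * u) (c * v)"
      for f :: "'a \<Rightarrow> 'a \<Rightarrow> 'a ^ 4"
    proof (rule vec.subspaceI)
      have "0 = f 0 0"
        using that(2)[of 0 0 0] by simp
      then show "0 \<in> {f u v |u v. True}"
        by blast
    next
      fix x y assume "x \<in> {f u v |u v. True}" "y \<in> {f u v |u v. True}"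
      then show "x + y \<in> {f u v |u v. True}"
        using that(1) by blast
    next
      fix c x assume "x \<in> {f u v |u v. True}"
      then show "c *s x \<in> {f u v |u v. True}"
        using that(2) by blast
    qed
    have T: "T1 = (\<lambda>(u, v). E u v 0 0) ` UNIV" "T2 = (\<lambda>(u, v). E 0 0 u v) ` UNIV"
      by (auto simp: T1_def T2_def)
    have "vec.subspace T1" "vec.subspace T2"
      unfolding T1_def T2_def by (rule graph; simp add: E_add E_scale)+
    moreover have "card T1 = CARD('a \<times> 'a)" "card T2 = CARD('a \<times> 'a)"
      unfolding T by (rule card_image; simp add: inj_def E_inj)+
    ultimately show "is_line T1" "is_line T2"
      by (simp_all add: is_line_iff_card power2_eq_square)
  qed
  have T_U: "points_on (linear_set U) T = {}" if "T = T1 \<or> T = T2" for T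
  proof -
    have False if "w \<in> U" "w \<noteq> 0" "w \<in> T" for w
      using that \<open>T = T1 \<or> T = T2\<close> by (auto simp: U T1_def T2_def E_inj E_0)
    moreover have "w \<in> T" if "vec.span {w} \<subseteq> T" for w
      using that vec.span_base[of w "{w}"] by blast
    ultimately show ?thesis
      by (auto simp: points_on_def linear_set_def)
  qed
  have T_meets: "meets T (l p)" if "p \<in> D" "T = T1 \<or> T = T2" for T p
  proof -
    obtain \<alpha> \<beta> where p: "p = (\<alpha>, \<beta>)" by (cases p)
    then have nz: "\<alpha> \<noteq> 0 \<or> \<beta> \<noteq> 0"
      using D that by force
    have "E (1 * \<alpha>) (1 * \<beta>) (0 * \<sigma> \<alpha>) (0 * \<sigma> \<beta>) \<in> l p" "E (0 * \<alpha>) (0 * \<beta>) (1 * \<sigma> \<alpha>) (1 * \<sigma> \<beta>) \<in> l p"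
      unfolding l_def p prod.case by blast+
    then have "E \<alpha> \<beta> 0 0 \<in> l p" "E 0 0 (\<sigma> \<alpha>) (\<sigma> \<beta>) \<in> l p"
      by simp_all
    moreover have "E \<alpha> \<beta> 0 0 \<in> T1" "E 0 0 (\<sigma> \<alpha>) (\<sigma> \<beta>) \<in> T2"
      by (auto simp: T1_def T2_def)
    moreover have "E \<alpha> \<beta> 0 0 \<noteq> 0" "E 0 0 (\<sigma> \<alpha>) (\<sigma> \<beta>) \<noteq> 0"
      using nz by (auto simp: E_eq_0)
    ultimately show ?thesis
      using that(2) unfolding meets_def by blast
  qed
  \<comment> \<open>A transversal is spanned by its points on the lines of (1, 0) and (0, 1). The
    remaining lines restrict these two points.\<close>
  have transversal: "T = T1 \<or> T = T2" if T: "is_line T" "\<And>p. p \<in> D \<Longrightarrow> meets T (l p)" for T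
  proof -
    have sub: "vec.subspace T" "\<And>p. p \<in> D \<Longrightarrow> vec.subspace (l p)"
      using T(1) line_l by (auto simp: is_line_def)
    have D3: "(1, 0) \<in> D" "(\<alpha>, 1) \<in> D" for \<alpha>
      by (auto simp: D_def)
    obtain w1 where w1: "w1 \<in> T" "w1 \<in> l (1, 0)" "w1 \<noteq> 0"
      using meetsD[OF T(2)[OF D3(1)] sub(1) sub(2)[OF D3(1)]] by blast
    then obtain s1 t1 where e: "E s1 0 t1 0 \<in> T" "s1 \<noteq> 0 \<or> t1 \<noteq> 0"
      by (auto simp: l_def E_eq_0)
    obtain w2 where w2: "w2 \<in> T" "w2 \<in> l (0, 1)" "w2 \<noteq> 0"
      using meetsD[OF T(2)[OF D3(2)[of 0]] sub(1) sub(2)[OF D3(2)[of 0]]] by blast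
    then obtain s2 t2 where f: "E 0 s2 0 t2 \<in> T" "s2 \<noteq> 0 \<or> t2 \<noteq> 0"
      by (auto simp: l_def E_eq_0)
    have T_eq: "T = (\<lambda>(p, p'). E (p * s1) (p' * s2) (p * t1) (p' * t2)) ` UNIV" (is "T = ?T'")
    proof (rule sym, rule card_subset_eq)
      show "?T' \<subseteq> T"
      proof clarify
        fix p p'
        have "p *s E s1 0 t1 0 + p' *s E 0 s2 0 t2 \<in> T"
          by (intro vec.subspace_add vec.subspace_scale sub(1) e(1) f(1))
        then show "E (p * s1) (p' * s2) (p * t1) (p' * t2) \<in> T"
          by (simp add: E_scale E_add)
      qed
      have "card ?T' = CARD('a \<times> 'a)"
        using e(2) f(2) by (intro card_image) (auto simp: inj_def E_inj)
      then show "card ?T' = card T"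
        using T(1) by (simp add: is_line_iff_card power2_eq_square)
    qed simp
    \<comment> \<open>A common vector with the line of (\<alpha>, 1) has two nonzero coefficients in
      these generators; k is their quotient.\<close>
    have ratio: "\<exists>k. k \<noteq> 0 \<and> k * s1 = s2 * \<alpha> \<and> k * t1 = t2 * \<sigma> \<alpha>" if "\<alpha> \<noteq> 0" for \<alpha>
    proof -
      obtain w where w: "w \<in> T" "w \<in> l (\<alpha>, 1)" "w \<noteq> 0"
        using meetsD[OF T(2)[OF D3(2)] sub(1) sub(2)[OF D3(2)]] by blast
      obtain s s' where ss': "w = E (s * \<alpha>) s (s' * \<sigma> \<alpha>) s'"
        using w(2) by (auto simp: l_def)
      obtain p p' where pp': "w = E (p * s1) (p' * s2) (p * t1) (p' * t2)"
        using w(1) unfolding T_eq by auto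
      have eqs: "p * s1 = p' * s2 * \<alpha>" "p * t1 = p' * t2 * \<sigma> \<alpha>"
        using ss' pp' by (auto simp: E_inj)
      have "p \<noteq> 0 \<or> p' \<noteq> 0"
        using w(3) pp' by (auto simp: E_0)
      then have "p \<noteq> 0" "p' \<noteq> 0"
        using eqs e(2) f(2) \<open>\<alpha> \<noteq> 0\<close> by auto
      then show ?thesis
        using eqs by (intro exI[of _ "p / p'"]) (simp add: field_simps)
    qed
    consider "s1 = 0" | "t1 = 0" | "s1 \<noteq> 0" "t1 \<noteq> 0" by blast
    then show ?thesis
    proof cases
      case 1
      then have "s2 = 0"
        using ratio[of 1] by auto
      then have "T \<subseteq> T2"
        unfolding T_eq T2_def using 1 by auto
      then show ?thesis
        using is_line_eq T(1) line_T by blast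
    next
      case 2
      then have "t2 = 0"
        using ratio[of 1] by auto
      then have "T \<subseteq> T1"
        unfolding T_eq T1_def using 2 by auto
      then show ?thesis
        using is_line_eq T(1) line_T by blast
    next
      case 3
      \<comment> \<open>Eliminating k makes \<sigma>(\<alpha>) a fixed multiple of \<alpha>;
        \<alpha> = 1 shows that the multiple is 1, contradicting the choice of
        \<open>\<alpha>0\<close>.\<close>
      have cross: "s2 * t1 * \<alpha> = s1 * t2 * \<sigma> \<alpha>" if nz: "\<alpha> \<noteq> 0" for \<alpha>
      proof -
        obtain k where "k * s1 = s2 * \<alpha>" "k * t1 = t2 * \<sigma> \<alpha>"
          using ratio[OF nz] by blast
        then show ?thesis
          by algebra
      qed
      have "s2 \<noteq> 0"
        using ratio[of 1] 3 by auto
      moreover have "\<alpha>0 \<noteq> 0"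
        using nontriv by auto
      ultimately have "\<sigma> \<alpha>0 = \<alpha>0"
        using cross[of 1] cross[of \<alpha>0] 3 by auto
      with nontriv show ?thesis ..
    qed
  qed
  have "E 1 0 0 0 \<in> T1" "E 1 0 0 0 \<notin> T2"
    by (auto simp: T1_def T2_def E_inj)
  then have "T1 \<noteq> T2"
    by blast
  then have "card {T1, T2} = 2"
    by simp
  moreover have "{t. is_line t \<and> points_on (linear_set U) t = {} \<and> (\<forall>m\<in>l ` D. meets t m)} = {T1, T2}"
  proof (intro equalityI subsetI)
    fix t assume "t \<in> {t. is_line t \<and> points_on (linear_set U) t = {} \<and> (\<forall>m\<in>l ` D. meets t m)}"
    then show "t \<in> {T1, T2}"
      using transversal[of t] by simp
  next
    fix t assume "t \<in> {T1, T2}"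
    then show "t \<in> {t. is_line t \<and> points_on (linear_set U) t = {} \<and> (\<forall>m\<in>l ` D. meets t m)}"
      using T_U[of t] T_meets[of _ t] line_T by auto
  qed
  ultimately have two: "card {t. is_line t \<and> points_on (linear_set U) t = {} \<and> (\<forall>m\<in>l ` D. meets t m)} = 2"
    by simp
  have disj: "p = p'" if "p \<in> D" "p' \<in> D" "meets (l p) (l p')" for p p'
    using meetsD[OF that(3)] line_l l_disjoint that(1,2) unfolding is_line_def by metis
  have "inj_on l D"
  proof (rule inj_onI)
    fix p p' assume *: "p \<in> D" "p' \<in> D" "l p = l p'"
    have "vec.subspace T1" "vec.subspace (l p)" "meets T1 (l p)"
      using line_T line_l[OF *(1)] T_meets[OF *(1)] by (auto simp: is_line_def)
    then obtain w where "w \<in> l p" "w \<noteq> 0"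
      using meetsD by blast
    then have "meets (l p) (l p')"
      using *(3) by (auto simp: meets_def)
    with * disj show "p = p'"
      by blast
  qed
  then have "card (l ` D) = CARD('k) ^ n + 1"
    by (simp only: card_image card_D)
  moreover have "\<forall>m\<in>l ` D. long_line \<iota> n U m"
    using long_l by blast
  moreover have "\<forall>m\<in>l ` D. \<forall>m'\<in>l ` D. m \<noteq> m' \<longrightarrow> \<not> meets m m'"
    using disj by blast
  ultimately show ?thesis
    unfolding pseudoregulus_type_def using scattered dim two by blast
qed

text \<open>For n = 3 the square of \<sigma> is its inverse. Hence (x, A(x)) and (u, \<sigma>(u)),
  with u = x - b A(x), are related by a matrix of determinant 1 + b c = 1 + N(a), which is
  nonzero.\<close>

lemma (in D_A_set) pseudoregulus_type_U:
  assumes n: "n = 3" and norm: "frob.norm a \<noteq> -1"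
  shows "pseudoregulus_type \<iota> n U"
proof -
  define b where "b = \<sigma>' a"
  define c where "c = a * \<sigma> a"
  define \<delta> where "\<delta> = 1 + b * c"
  have m: "m = 1 \<or> m = 2"
    using m_bounds n by auto
  have "frob.norm a = (\<Prod>i<3. (frobenius ^^ i) a)"
    unfolding frob.norm_def by (simp only: n)
  also have "\<dots> = a * frobenius a * frobenius (frobenius a)"
    by (simp add: numeral_3_eq_3 mult_ac)
  also have "\<dots> = \<sigma>' a * (a * \<sigma> a)"
  proof -
    have "\<sigma>' a = (frobenius ^^ (3 - m)) a"
      by (simp only: n)
    then show ?thesis
      using m by (auto simp: numeral_2_eq_2 mult_ac)
  qed
  finally have "frob.norm a = b * c"
    by (simp only: b_def c_def)
  then have \<delta>: "\<delta> \<noteq> 0"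
    using norm by (auto simp: \<delta>_def add_eq_0_iff)
  have \<sigma>\<sigma>: "\<sigma> (\<sigma> x) = \<sigma>' x" for x
  proof -
    have "(m + m) mod n = n - m"
      using m n by auto
    then have "frobenius ^^ (m + m) = \<sigma>'"
      using frob.pow_mod[of "m + m"] by simp
    then show ?thesis
      by (simp add: funpow_add fun_eq_iff)
  qed
  \<comment> \<open>The inverse matrix applied to (u, s) and to (v, t), with the results placed in
    the order of the coordinates of \<open>pt\<close>.\<close>
  define E where "E u v s t = (vector [(u + b * s) / \<delta>, (v + b * t) / \<delta>, (t - c * v) / \<delta>,
      \<iota> \<xi> * ((s - c * u) / \<delta>)] :: 'a ^ 4)" for u v s t
  define f where "f x = x - b * A x" for x
  \<comment> \<open>The choice of b gives \<sigma>(b) = a, so the expansion reproduces A(x) and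
    leaves only a multiple of x.\<close>
  have \<sigma>f: "\<sigma> (f x) = c * x + A x" for x
  proof -
    have "\<sigma> (A x) = \<sigma>' x - \<sigma> a * x"
      by (simp add: A_eq S.hom \<sigma>\<sigma>)
    then show ?thesis
      by (simp add: f_def S.hom b_def c_def A_eq algebra_simps)
  qed
  have f_\<delta>: "f x + b * \<sigma> (f x) = \<delta> * x" "\<sigma> (f x) - c * f x = \<delta> * A x" for x
    unfolding \<sigma>f by (simp_all add: f_def \<delta>_def algebra_simps)
  have pt_E: "pt x y = E (f x) (f y) (\<sigma> (f x)) (\<sigma> (f y))" for x y
    using \<delta> by (simp add: pt_def E_def f_\<delta>)
  have "inj f"
  proof (rule injI)
    fix x y assume "f x = f y"
    then have "\<delta> * x = \<delta> * y"
      by (simp flip: f_\<delta>(1))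
    then show "x = y"
      using \<delta> by simp
  qed
  then have surj: "surj f"
    by (simp add: finite_UNIV_inj_surj)
  have U: "U = {E u v (\<sigma> u) (\<sigma> v) |u v. True}"
  proof (intro equalityI subsetI)
    fix w assume "w \<in> {E u v (\<sigma> u) (\<sigma> v) |u v. True}"
    then obtain u v where w: "w = E u v (\<sigma> u) (\<sigma> v)"
      by blast
    obtain x y where "u = f x" "v = f y"
      using surj by (meson surjD)
    then have "w = pt x y"
      by (simp add: w pt_E)
    then show "w \<in> U"
      by simp
  qed (auto simp: U_iff pt_E)
  have E_inj: "E u v s t = E u' v' s' t' \<longleftrightarrow> u = u' \<and> v = v' \<and> s = s' \<and> t = t'" for u v s t u' v' s' t'
  proof
    have solve: "u = u' \<and> s = s'" if "u + b * s = u' + b * s'" "s - c * u = s' - c * u'" for u s u' s'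
    proof -
      have "\<delta> * u = \<delta> * u'" "\<delta> * s = \<delta> * s'"
        unfolding \<delta>_def using that by algebra+
      then show ?thesis
        using \<delta> by simp
    qed
    assume "E u v s t = E u' v' s' t'"
    then have "u + b * s = u' + b * s'" "s - c * u = s' - c * u'"
      "v + b * t = v' + b * t'" "t - c * v = t' - c * v'"
      using \<delta> \<xi>_nz by (simp_all add: E_def vec4_eq_iff)
    then show "u = u' \<and> v = v' \<and> s = s' \<and> t = t'"
      using solve[of u s u' s'] solve[of v t v' t'] by simp
  qed simp
  obtain \<alpha>0 where "\<sigma> \<alpha>0 \<noteq> \<alpha>0"
  proof -
    have "card K < card (UNIV :: 'a set)"
      using power_strict_increasing[of 1 n q] q_gt_1 n card_range card_a by simp
    then have "K \<noteq> UNIV"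
      by (metis less_irrefl)
    then show ?thesis
      using that \<sigma>_fixed_iff(1) by blast
  qed
  have "maximum_scattered \<iota> n U"
    using norm by (rule maximum_scattered_U)
  then have sc: "scattered \<iota> U" "sub_dim \<iota> U = 2 * n"
    by (simp_all add: maximum_scattered_def)
  show ?thesis
  proof (rule pseudoregulus_typeI[OF sc S.field_aut_axioms \<open>\<sigma> \<alpha>0 \<noteq> \<alpha>0\<close> _ _ E_inj U])
    show "E u v s t + E u' v' s' t' = E (u + u') (v + v') (s + s') (t + t')" for u v s t u' v' s' t'
      by (simp add: E_def vec4_eq_iff add_divide_distrib diff_divide_distrib distrib_left right_diff_distrib)
    show "k *s E u v s t = E (k * u) (k * v) (k * s) (k * t)" for k u v s t
      by (simp add: E_def vec4_eq_iff add_divide_distrib diff_divide_distrib distrib_left right_diff_distrib mult_ac)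
  qed
qed

theorem theorem4p4:
  fixes \<iota> :: "'k::{field,finite} \<Rightarrow> 'a::{field,finite}"
    and q n :: nat and r :: int and \<xi> :: 'k and a :: 'a
  assumes "primepow q" and "odd q"
    and "n \<ge> 3" and "odd n"
    and "CARD('k) = q" and "CARD('a) = q ^ n" and "field_embedding \<iota>"
    and "\<not> (\<exists>z. z ^ 2 = \<xi>)"
    and "coprime (int n) r"
    and "a \<noteq> 0" and "field_norm q n a \<noteq> 1"
  defines "U \<equiv> D_A q n a r (\<iota> \<xi>)"
  shows "(field_norm q n a \<noteq> -1 \<and> n = 3 \<longrightarrow>
            maximum_scattered \<iota> n U \<and> pseudoregulus_type \<iota> n U) \<and>
         (field_norm q n a \<noteq> -1 \<and> n > 3 \<longrightarrow>
            maximum_scattered \<iota> n U \<and>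
            line_X1_X2 \<noteq> (line_X0_X3 :: ('a ^ 4) set) \<and>
            long_line \<iota> n U line_X1_X2 \<and> \<not> line_of_pseudoregulus_type \<iota> U line_X1_X2 \<and>
            long_line \<iota> n U line_X0_X3 \<and> \<not> line_of_pseudoregulus_type \<iota> U line_X0_X3) \<and>
         (field_norm q n a = -1 \<longrightarrow>
            (\<forall>P \<in> linear_set U. weight \<iota> U P > 1 \<longrightarrow> weight \<iota> U P = 2) \<and>
            real (card {P \<in> linear_set U. weight \<iota> U P > 1}) =
              (real q ^ (n - 1) - 1) / (real q - 1) \<and>
            real (card (linear_set U)) = (real q ^ (2 * n) - real q ^ n) / (real q - 1) + 1)"
proof -
  have "\<xi> \<noteq> 0"
    using assms(8) by force
  have ext: "finite_field_ext \<iota> q n"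
    using assms by unfold_locales
  then interpret finite_field_ext \<iota> q n .
  interpret D_A_set \<iota> q n r a \<xi>
    using assms \<open>\<xi> \<noteq> 0\<close> by unfold_locales (simp_all add: field_norm_eq)
  have U: "U = D_A_set.U \<iota> q n r a \<xi>"
    by (simp add: assms(12) U_def)
  show ?thesis
    unfolding U field_norm_eq
    using maximum_scattered_U pseudoregulus_type_U lines_distinct long_lines
      lines_not_pseudoregulus_type points_norm_minus_1 by blast
qed

end
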